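(* Let $\psi\in C^2(\mathbb{R})$ satisfy $\psi''(x)>0$ for all $x\in\mathbb{R}$, and let $t\in(1,2)$. There is a constant $C=C(\psi,t)>0$ such that for all finite Borel measures $\mu$ and $\nu$ with compact support on $B(1)\subset\mathbb{R}^2$ and every $\delta\in(0,1)$, $$ \mathcal{I}_\delta(\mu,\nu)\le C\,\delta\,\sqrt{\mathrm{I}_{3-t}(\mu)\,\mathrm{I}_t(\nu)}. $$
   Context: Let $\Gamma=\{(x,\psi(x)):x\in[-1,1]\}$. For $q\in\mathbb{R}^2$ let $\Gamma_q:=q+\Gamma$, and let $\Gamma_q(\delta)$ be the closed $\delta$-neighbourhood of $\Gamma_q$. The $\delta$-incidences of finite Borel measures $\mu,\nu$ on $\mathbb{R}^2$ are $$\mathcal{I}_\delta(\mu,\nu):=(\mu\times\nu)\big(\{(p,q)\in\mathbb{R}^2\times\mathbb{R}^2:\ p\in\Gamma_q(\delta)\}\big).$$ For $0<\omega<2$, the Riesz energy is $\mathrm{I}_\omega(\mu):=\iint|x-y|^{-\omega}\,d\mu(x)\,d\mu(y)$. $B(1)$ is the unit ball of $\mathbb{R}^2$ centred at the origin. *)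

theory Defs
  imports "HOL-Analysis.Analysis"
begin

text \<open>The plane is \<^typ>\<open>real \<times> real\<close>, whose product norm is the Euclidean one.\<close>

definition curve_graph :: "(real \<Rightarrow> real) \<Rightarrow> (real \<times> real) set" where
  "curve_graph \<psi> = (\<lambda>x. (x, \<psi> x)) ` {-1..1}"

definition translated_graph :: "(real \<Rightarrow> real) \<Rightarrow> real \<times> real \<Rightarrow> (real \<times> real) set" where
  "translated_graph \<psi> q = (\<lambda>z. q + z) ` curve_graph \<psi>"

definition closed_nbhd :: "'a::metric_space set \<Rightarrow> real \<Rightarrow> 'a set" where
  "closed_nbhd A \<delta> = {p. infdist p A \<le> \<delta>}"

definition incidences ::
  "(real \<Rightarrow> real) \<Rightarrow> real \<Rightarrow> (real \<times> real) measure \<Rightarrow> (real \<times> real) measure \<Rightarrow> ennreal" where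
  "incidences \<psi> \<delta> \<mu> \<nu> =
     emeasure (\<mu> \<Otimes>\<^sub>M \<nu>) {(p, q). p \<in> closed_nbhd (translated_graph \<psi> q) \<delta>}"

text \<open>The diagonal is treated separately because \<^term>\<open>0 powr (- \<omega>) = (0::real)\<close>,
  whereas the Riesz kernel is infinite there; in particular atoms have infinite energy.\<close>

definition riesz_kernel :: "real \<Rightarrow> 'a::metric_space \<Rightarrow> 'a \<Rightarrow> ennreal" where
  "riesz_kernel \<omega> x y = (if x = y then \<infinity> else ennreal (dist x y powr (- \<omega>)))"

definition riesz_energy :: "real \<Rightarrow> 'a::metric_space measure \<Rightarrow> ennreal" where
  "riesz_energy \<omega> \<mu> = (\<integral>\<^sup>+ x. (\<integral>\<^sup>+ y. riesz_kernel \<omega> x y \<partial>\<mu>) \<partial>\<mu>)"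

definition ennreal_sqrt :: "ennreal \<Rightarrow> ennreal" where
  "ennreal_sqrt x = (if x = \<infinity> then \<infinity> else ennreal (sqrt (enn2real x)))"

definition finite_borel_measure :: "'a::topological_space measure \<Rightarrow> bool" where
  "finite_borel_measure \<mu> \<longleftrightarrow> sets \<mu> = sets borel \<and> finite_measure \<mu>"

definition measure_support :: "'a::topological_space measure \<Rightarrow> 'a set" where
  "measure_support \<mu> = {x. \<forall>U. open U \<longrightarrow> x \<in> U \<longrightarrow> emeasure \<mu> U > 0}"

lemma ennreal_sqrt_power2: "(ennreal_sqrt x)\<^sup>2 = x"
  by (cases x) (auto simp: ennreal_sqrt_def power2_eq_square ennreal_mult_top simp flip: ennreal_mult)

lemma closed_incidence_set:
  "closed {(p, q). p \<in> closed_nbhd (translated_graph \<psi> q) \<delta>}"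
proof -
  have "infdist p (translated_graph \<psi> q) = infdist (p - q) (curve_graph \<psi>)" for p q
    by (simp add: infdist_def translated_graph_def image_image dist_norm diff_diff_eq)
  then have "{(p, q). p \<in> closed_nbhd (translated_graph \<psi> q) \<delta>} =
      {z. infdist (fst z - snd z) (curve_graph \<psi>) \<le> \<delta>}"
    by (auto simp: closed_nbhd_def)
  then show ?thesis
    by (simp add: closed_Collect_le continuous_intros)
qed

lemma incidence_set_measurable:
  assumes "finite_borel_measure \<mu>" "finite_borel_measure \<nu>"
  shows "{(p, q). p \<in> closed_nbhd (translated_graph \<psi> q) \<delta>} \<in> sets (\<mu> \<Otimes>\<^sub>M \<nu>)"
proof -
  have "sets (\<mu> \<Otimes>\<^sub>M \<nu>) = sets (borel \<Otimes>\<^sub>M borel)"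
    using assms by (intro sets_pair_measure_cong) (auto simp: finite_borel_measure_def)
  also have "\<dots> = sets borel"
    by (simp only: borel_prod)
  finally show ?thesis
    using closed_incidence_set by (metis borel_closed)
qed

end

theory Submission
  imports "HOL-Probability.Probability" Defs
begin

text \<open>The indicator of the incidence set is at most a constant times \<open>1/\<delta>\<close> times the average
  over the curve of the Gaussian of width \<open>\<delta>\<close>. Writing that Gaussian as a Fourier integral turns the
  incidences into \<open>C \<delta> \<integral> |\<mu>^(\<xi>)| |\<nu>^(\<xi>)| |\<sigma>^(\<xi>)| d\<xi>\<close>, where \<open>\<sigma>\<close> is the measure \<open>dx\<close> carried by
  the curve. By van der Corput's lemma \<open>|\<sigma>^(\<xi>)| \<le> C |\<xi>|\<^sup>-\<^sup>1\<^sup>/\<^sup>2\<close>, and since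
  \<open>-1/2 = (1 - t)/2 + (t - 2)/2\<close>, Cauchy-Schwarz bounds the integral by the square root of the product of
  \<open>\<integral> |\<mu>^|\<^sup>2 |\<xi>|\<^sup>\<omega>\<^sup>-\<^sup>2\<close> for \<open>\<omega> = 3 - t\<close> and the same integral of \<open>\<nu>\<close> for \<open>\<omega> = t\<close>. These are
  dominated by the Riesz energies, because \<open>|\<xi>|\<^sup>\<omega>\<^sup>-\<^sup>2\<close> is a superposition of Gaussians.\<close>

subsection \<open>Gaussian integrals and Fourier transforms\<close>

lemma cis_borel_measurable [measurable]: "cis \<in> borel_measurable borel"
  by (intro borel_measurable_continuous_onI continuous_intros)

text \<open>Used with characters as factors: it makes the Fourier transform of a product measure a
  product of Fourier transforms.\<close>

lemma (in pair_sigma_finite)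
  fixes f g :: "_ \<Rightarrow> complex"
  assumes f: "integrable M1 f" and g: "integrable M2 g"
  shows integrable_pair_mult: "integrable (M1 \<Otimes>\<^sub>M M2) (\<lambda>(x, y). f x * g y)"
    and integral_pair_mult:
      "(\<integral>z. (case z of (x, y) \<Rightarrow> f x * g y) \<partial>(M1 \<Otimes>\<^sub>M M2)) = (\<integral>x. f x \<partial>M1) * (\<integral>y. g y \<partial>M2)"
proof -
  have [measurable]: "f \<in> borel_measurable M1" "g \<in> borel_measurable M2"
    using f g by auto
  show int: "integrable (M1 \<Otimes>\<^sub>M M2) (\<lambda>(x, y). f x * g y)"
    by (rule Fubini_integrable) (use f g in \<open>auto simp: norm_mult\<close>)
  show "(\<integral>z. (case z of (x, y) \<Rightarrow> f x * g y) \<partial>(M1 \<Otimes>\<^sub>M M2)) = (\<integral>x. f x \<partial>M1) * (\<integral>y. g y \<partial>M2)"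
    by (subst integral_fst [OF int, symmetric]) simp
qed

text \<open>Rescaling by \<open>c = 1 / sqrt (2 * r)\<close> turns the Gaussian into the standard
  normal density, whose characteristic function is known.\<close>

lemma
  fixes r t :: real
  assumes r: "r > 0"
  shows integrable_gaussian_cis: "integrable lborel (\<lambda>x. complex_of_real (exp (- r * x\<^sup>2)) * cis (t * x))"
    and integral_gaussian_cis: "(\<integral>x. complex_of_real (exp (- r * x\<^sup>2)) * cis (t * x) \<partial>lborel)
       = complex_of_real (sqrt (pi / r) * exp (- t\<^sup>2 / (4 * r)))"
proof -
  define c where "c = 1 / sqrt (2 * r)"
  have c: "c > 0" "r * c\<^sup>2 = 1 / 2"
    using r by (auto simp: c_def power_divide)
  \<comment> \<open>The summand \<open>0\<close> is the shift in the affine change of variables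
    \<open>x \<mapsto> 0 + c * x\<close>, kept so that the integrands match syntactically.\<close>
  have *: "complex_of_real (exp (- r * (0 + c * x)\<^sup>2)) * cis (t * (0 + c * x))
      = of_real (sqrt (2 * pi)) * (std_normal_density x *\<^sub>R cis (t * c * x))" for x
  proof -
    have "- r * (0 + c * x)\<^sup>2 = - x\<^sup>2 / 2"
      using c(2) by (simp add: power_mult_distrib)
    then have "exp (- r * (0 + c * x)\<^sup>2) = sqrt (2 * pi) * std_normal_density x"
      by (simp only: std_normal_density_def) simp
    then show ?thesis
      by (simp add: scaleR_conv_of_real mult_ac)
  qed
  have int: "integrable lborel (\<lambda>x. std_normal_density x *\<^sub>R cis (t * c * x))"
    by (rule Bochner_Integration.integrable_bound [OF integrable_normal_density [of 1 0]])
      (auto simp: cis_conv_exp)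
  show "integrable lborel (\<lambda>x. complex_of_real (exp (- r * x\<^sup>2)) * cis (t * x))"
    using lborel_integrable_real_affine_iff
      [of c "\<lambda>x. complex_of_real (exp (- r * x\<^sup>2)) * cis (t * x)" 0, unfolded *]
      c(1) integrable_mult_right [OF int] by auto
  have "(\<integral>x. std_normal_density x *\<^sub>R cis (t * c * x) \<partial>lborel) = char std_normal_distribution (t * c)"
    unfolding char_def by (subst integral_density) (auto simp: cis_conv_exp)
  then have I: "(\<integral>x. std_normal_density x *\<^sub>R cis (t * c * x) \<partial>lborel) = of_real (exp (- (t * c)\<^sup>2 / 2))"
    by (simp add: char_std_normal_distribution)
  have "(\<integral>x. complex_of_real (exp (- r * x\<^sup>2)) * cis (t * x) \<partial>lborel)
     = \<bar>c\<bar> *\<^sub>R (\<integral>x. complex_of_real (exp (- r * (0 + c * x)\<^sup>2)) * cis (t * (0 + c * x)) \<partial>lborel)"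
    by (rule lborel_integral_real_affine) (use c in auto)
  also have "\<dots> = of_real (c * sqrt (2 * pi) * exp (- (t * c)\<^sup>2 / 2))"
    unfolding * using c I by (simp add: scaleR_conv_of_real)
  also have "c * sqrt (2 * pi) = sqrt (pi / r)"
    by (simp add: c_def real_sqrt_mult real_sqrt_divide)
  also have "- (t * c)\<^sup>2 / 2 = - t\<^sup>2 / (4 * r)"
    using c r by (simp add: power_mult_distrib c_def power_divide)
  finally show "(\<integral>x. complex_of_real (exp (- r * x\<^sup>2)) * cis (t * x) \<partial>lborel)
       = complex_of_real (sqrt (pi / r) * exp (- t\<^sup>2 / (4 * r)))" .
qed

lemma norm_prod_power2: "(norm (\<xi> :: real \<times> real))\<^sup>2 = (fst \<xi>)\<^sup>2 + (snd \<xi>)\<^sup>2"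
  by (cases \<xi>) (simp add: norm_Pair)

text \<open>Both the Gaussian and the character split over the two coordinates, so the integral is a
  product of two one-dimensional ones.\<close>

lemma
  fixes r :: real and x :: "real \<times> real"
  assumes r: "r > 0"
  shows integrable_gaussian_cis2: "integrable lborel (\<lambda>\<xi>. complex_of_real (exp (- r * (norm \<xi>)\<^sup>2)) * cis (x \<bullet> \<xi>))"
    and integral_gaussian_cis2: "(\<integral>\<xi>. complex_of_real (exp (- r * (norm \<xi>)\<^sup>2)) * cis (x \<bullet> \<xi>) \<partial>lborel)
       = complex_of_real (pi / r * exp (- (norm x)\<^sup>2 / (4 * r)))"
proof -
  obtain a b where x: "x = (a, b)" by (cases x)
  have *: "(\<lambda>\<xi>. complex_of_real (exp (- r * (norm \<xi>)\<^sup>2)) * cis (x \<bullet> \<xi>)) =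
     (\<lambda>(u, v). complex_of_real (exp (- r * u\<^sup>2)) * cis (a * u) * (complex_of_real (exp (- r * v\<^sup>2)) * cis (b * v)))"
  proof (intro ext, clarify)
    fix u v :: real
    have "exp (- r * (norm (u, v))\<^sup>2) = exp (- r * u\<^sup>2) * exp (- r * v\<^sup>2)"
      by (simp add: norm_prod_power2 ring_distribs flip: exp_add)
    moreover have "cis (x \<bullet> (u, v)) = cis (a * u) * cis (b * v)"
      by (simp add: x cis_mult)
    ultimately show "complex_of_real (exp (- r * (norm (u, v))\<^sup>2)) * cis (x \<bullet> (u, v)) =
        complex_of_real (exp (- r * u\<^sup>2)) * cis (a * u) * (complex_of_real (exp (- r * v\<^sup>2)) * cis (b * v))"
      by (simp only: of_real_mult mult_ac)
  qed
  note i = integrable_gaussian_cis [OF r]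
  show "integrable lborel (\<lambda>\<xi>. complex_of_real (exp (- r * (norm \<xi>)\<^sup>2)) * cis (x \<bullet> \<xi>))"
    unfolding * lborel_prod [symmetric] by (rule lborel_pair.integrable_pair_mult [OF i i])
  have "(\<integral>\<xi>. complex_of_real (exp (- r * (norm \<xi>)\<^sup>2)) * cis (x \<bullet> \<xi>) \<partial>lborel)
      = of_real (sqrt (pi / r) * exp (- a\<^sup>2 / (4 * r))) * of_real (sqrt (pi / r) * exp (- b\<^sup>2 / (4 * r)))"
    unfolding * lborel_prod [symmetric] lborel_pair.integral_pair_mult [OF i i]
      integral_gaussian_cis [OF r] ..
  also have "\<dots> = of_real ((sqrt (pi / r) * sqrt (pi / r)) * (exp (- a\<^sup>2 / (4 * r)) * exp (- b\<^sup>2 / (4 * r))))"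
    by (simp only: of_real_mult mult_ac)
  also have "sqrt (pi / r) * sqrt (pi / r) = pi / r"
    using r by simp
  also have "exp (- a\<^sup>2 / (4 * r)) * exp (- b\<^sup>2 / (4 * r)) = exp (- (norm x)\<^sup>2 / (4 * r))"
    by (simp add: x norm_prod_power2 add_divide_distrib diff_divide_distrib flip: exp_add)
  finally show "(\<integral>\<xi>. complex_of_real (exp (- r * (norm \<xi>)\<^sup>2)) * cis (x \<bullet> \<xi>) \<partial>lborel)
       = complex_of_real (pi / r * exp (- (norm x)\<^sup>2 / (4 * r)))" .
qed

text \<open>Fubini, followed by the explicit transform of the Gaussian. The measure lives on an
  arbitrary space and is carried to the plane by \<open>\<theta>\<close>, so that product measures
  can be used with \<open>\<theta>\<close> a difference of points.\<close>

lemma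
  fixes \<theta> :: "'a \<Rightarrow> real \<times> real"
  assumes "finite_measure M" and \<theta>[measurable]: "\<theta> \<in> borel_measurable M" and r: "r > 0"
  shows integrable_gaussian_fourier:
     "integrable lborel (\<lambda>\<xi>. complex_of_real (exp (- r * (norm \<xi>)\<^sup>2)) * (\<integral>x. cis (\<theta> x \<bullet> \<xi>) \<partial>M))"
    and gaussian_fourier:
     "(\<integral>\<xi>. complex_of_real (exp (- r * (norm \<xi>)\<^sup>2)) * (\<integral>x. cis (\<theta> x \<bullet> \<xi>) \<partial>M) \<partial>lborel)
      = complex_of_real (pi / r * (\<integral>x. exp (- (norm (\<theta> x))\<^sup>2 / (4 * r)) \<partial>M))"
proof -
  interpret M: finite_measure M by fact
  interpret P: pair_sigma_finite M lborel ..
  define F where "F x \<xi> = complex_of_real (exp (- r * (norm \<xi>)\<^sup>2)) * cis (\<theta> x \<bullet> \<xi>)" for x \<xi>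
  have [measurable]: "case_prod F \<in> borel_measurable (M \<Otimes>\<^sub>M lborel)"
    unfolding F_def by measurable
  have nF: "norm (F x \<xi>) = exp (- r * (norm \<xi>)\<^sup>2)" for x \<xi>
    by (simp add: F_def norm_mult del: of_real_exp)
  have int: "integrable (M \<Otimes>\<^sub>M lborel) (case_prod F)"
  \<comment> \<open>The norm of \<open>F x \<xi>\<close> does not depend on \<open>x\<close>, so the
    iterated integral of norms is a constant integrated over a finite measure.\<close>
  proof (rule P.Fubini_integrable)
    show "integrable M (\<lambda>x. \<integral>y. norm (case (x, y) of (x, y) \<Rightarrow> F x y) \<partial>lborel)"
      by (simp add: nF)
    show "AE x in M. integrable lborel (\<lambda>y. case (x, y) of (x, y) \<Rightarrow> F x y)"
      using integrable_gaussian_cis2 [OF r] by (simp add: F_def)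
  qed measurable
  have 1: "(\<integral>x. F x \<xi> \<partial>M) = complex_of_real (exp (- r * (norm \<xi>)\<^sup>2)) * (\<integral>x. cis (\<theta> x \<bullet> \<xi>) \<partial>M)" for \<xi>
    by (simp add: F_def)
  show "integrable lborel (\<lambda>\<xi>. complex_of_real (exp (- r * (norm \<xi>)\<^sup>2)) * (\<integral>x. cis (\<theta> x \<bullet> \<xi>) \<partial>M))"
    using P.integrable_snd [OF int] by (simp only: 1)
  have "(\<integral>\<xi>. complex_of_real (exp (- r * (norm \<xi>)\<^sup>2)) * (\<integral>x. cis (\<theta> x \<bullet> \<xi>) \<partial>M) \<partial>lborel)
     = (\<integral>x. (\<integral>\<xi>. F x \<xi> \<partial>lborel) \<partial>M)"
    using P.Fubini_integral [OF int] by (simp only: 1)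
  also have "\<dots> = (\<integral>x. complex_of_real (pi / r * exp (- (norm (\<theta> x))\<^sup>2 / (4 * r))) \<partial>M)"
    by (simp only: F_def integral_gaussian_cis2 [OF r])
  also have "\<dots> = complex_of_real (\<integral>x. pi / r * exp (- (norm (\<theta> x))\<^sup>2 / (4 * r)) \<partial>M)"
    by (rule integral_complex_of_real)
  also have "(\<integral>x. pi / r * exp (- (norm (\<theta> x))\<^sup>2 / (4 * r)) \<partial>M) = pi / r * (\<integral>x. exp (- (norm (\<theta> x))\<^sup>2 / (4 * r)) \<partial>M)"
    by simp
  finally show "(\<integral>\<xi>. complex_of_real (exp (- r * (norm \<xi>)\<^sup>2)) * (\<integral>x. cis (\<theta> x \<bullet> \<xi>) \<partial>M) \<partial>lborel)
      = complex_of_real (pi / r * (\<integral>x. exp (- (norm (\<theta> x))\<^sup>2 / (4 * r)) \<partial>M))" .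
qed

section \<open>Fourier transforms of finite measures in the plane\<close>

definition fourier_measure :: "(real \<times> real) measure \<Rightarrow> real \<times> real \<Rightarrow> complex" where
  "fourier_measure \<mu> \<xi> = (\<integral>x. cis (x \<bullet> \<xi>) \<partial>\<mu>)"

lemma fourier_measure_borel_measurable [measurable]:
  fixes \<mu> :: "(real \<times> real) measure"
  assumes "finite_borel_measure \<mu>"
  shows "fourier_measure \<mu> \<in> borel_measurable borel"
proof -
  have [measurable_cong]: "sets \<mu> = sets borel" and "finite_measure \<mu>"
    using assms by (auto simp: finite_borel_measure_def)
  interpret finite_measure \<mu> by fact
  show ?thesis
    unfolding fourier_measure_def by measurable
qed

lemma fourier_measure_uminus: "fourier_measure \<mu> (- \<xi>) = cnj (fourier_measure \<mu> \<xi>)"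
  unfolding fourier_measure_def by (simp flip: cis_cnj Bochner_Integration.integral_cnj)

text \<open>The squared modulus of the transform is itself the transform of the image of
  \<open>\<mu> \<Otimes>\<^sub>M \<mu>\<close> under \<open>(x, y) \<mapsto> x - y\<close>, because
  conjugation corresponds to \<open>- \<xi>\<close>. Applying \<open>gaussian_fourier\<close> to
  that difference map gives the identity.\<close>

lemma gaussian_weighted_fourier_square:
  fixes \<mu> :: "(real \<times> real) measure"
  assumes \<mu>: "finite_borel_measure \<mu>" and r: "r > 0"
  shows "(\<integral>\<^sup>+\<xi>. ennreal (exp (- r * (norm \<xi>)\<^sup>2) * (norm (fourier_measure \<mu> \<xi>))\<^sup>2) \<partial>lborel)
       = ennreal (pi / r) * (\<integral>\<^sup>+x. \<integral>\<^sup>+y. ennreal (exp (- (dist x y)\<^sup>2 / (4 * r))) \<partial>\<mu> \<partial>\<mu>)"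
proof -
  have [measurable_cong]: "sets \<mu> = sets borel" and "finite_measure \<mu>"
    using \<mu> by (auto simp: finite_borel_measure_def)
  interpret finite_measure \<mu> by fact
  interpret P: pair_sigma_finite \<mu> \<mu> ..
  have fin: "finite_measure (\<mu> \<Otimes>\<^sub>M \<mu>)"
    by (intro finite_measure_pair_measure) fact+
  interpret PP: finite_measure "\<mu> \<Otimes>\<^sub>M \<mu>" by fact
  define \<theta> :: "(real \<times> real) \<times> (real \<times> real) \<Rightarrow> real \<times> real" where "\<theta> z = fst z - snd z" for z
  have [measurable]: "\<theta> \<in> borel_measurable (\<mu> \<Otimes>\<^sub>M \<mu>)"
    unfolding \<theta>_def by measurable
  have int: "integrable \<mu> (\<lambda>x. cis (x \<bullet> \<xi>))" for \<xi>
    by (rule integrable_const_bound [of _ 1]) auto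
  have sq: "(\<integral>z. cis (\<theta> z \<bullet> \<xi>) \<partial>(\<mu> \<Otimes>\<^sub>M \<mu>)) = complex_of_real ((norm (fourier_measure \<mu> \<xi>))\<^sup>2)" for \<xi>
  proof -
    have "(\<integral>z. cis (\<theta> z \<bullet> \<xi>) \<partial>(\<mu> \<Otimes>\<^sub>M \<mu>))
        = (\<integral>z. (case z of (x, y) \<Rightarrow> cis (x \<bullet> \<xi>) * cis (y \<bullet> (- \<xi>))) \<partial>(\<mu> \<Otimes>\<^sub>M \<mu>))"
      by (simp add: \<theta>_def case_prod_unfold inner_diff_left cis_mult)
    also have "\<dots> = fourier_measure \<mu> \<xi> * fourier_measure \<mu> (- \<xi>)"
      unfolding fourier_measure_def by (rule P.integral_pair_mult [OF int int])
    finally show ?thesis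
      by (simp add: fourier_measure_uminus complex_norm_square del: of_real_power)
  qed
  let ?g = "\<lambda>\<xi>. exp (- r * (norm \<xi>)\<^sup>2) * (norm (fourier_measure \<mu> \<xi>))\<^sup>2"
  have eq: "complex_of_real (exp (- r * (norm \<xi>)\<^sup>2)) * (\<integral>z. cis (\<theta> z \<bullet> \<xi>) \<partial>(\<mu> \<Otimes>\<^sub>M \<mu>))
      = complex_of_real (?g \<xi>)" for \<xi>
    unfolding sq by (rule of_real_mult [symmetric])
  have ing: "integrable lborel (\<lambda>\<xi>. complex_of_real (?g \<xi>))"
    using integrable_gaussian_fourier [OF fin _ r, of \<theta>] unfolding eq by simp
  then have ing': "integrable lborel ?g"
    using integrable_Re by fastforce
  have "complex_of_real (\<integral>\<xi>. ?g \<xi> \<partial>lborel) = (\<integral>\<xi>. complex_of_real (?g \<xi>) \<partial>lborel)"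
    by (rule integral_complex_of_real [symmetric])
  also have "\<dots> = complex_of_real (pi / r * (\<integral>z. exp (- (norm (\<theta> z))\<^sup>2 / (4 * r)) \<partial>(\<mu> \<Otimes>\<^sub>M \<mu>)))"
    using gaussian_fourier [OF fin _ r, of \<theta>] unfolding eq by simp
  finally have A: "(\<integral>\<xi>. ?g \<xi> \<partial>lborel) = pi / r * (\<integral>z. exp (- (norm (\<theta> z))\<^sup>2 / (4 * r)) \<partial>(\<mu> \<Otimes>\<^sub>M \<mu>))"
    by (simp only: of_real_eq_iff)
  have "integrable (\<mu> \<Otimes>\<^sub>M \<mu>) (\<lambda>z. exp (- (norm (\<theta> z))\<^sup>2 / (4 * r)))"
    using r by (intro PP.integrable_const_bound [of _ 1]) auto
  then have B: "(\<integral>\<^sup>+z. ennreal (exp (- (norm (\<theta> z))\<^sup>2 / (4 * r))) \<partial>(\<mu> \<Otimes>\<^sub>M \<mu>))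
      = ennreal (\<integral>z. exp (- (norm (\<theta> z))\<^sup>2 / (4 * r)) \<partial>(\<mu> \<Otimes>\<^sub>M \<mu>))"
    by (intro nn_integral_eq_integral) auto
  have "(\<integral>\<^sup>+\<xi>. ennreal (?g \<xi>) \<partial>lborel) = ennreal (\<integral>\<xi>. ?g \<xi> \<partial>lborel)"
    by (intro nn_integral_eq_integral ing') auto
  also have "\<dots> = ennreal (pi / r) * (\<integral>\<^sup>+z. ennreal (exp (- (norm (\<theta> z))\<^sup>2 / (4 * r))) \<partial>(\<mu> \<Otimes>\<^sub>M \<mu>))"
    unfolding A B using r by (intro ennreal_mult) auto
  also have "(\<integral>\<^sup>+z. ennreal (exp (- (norm (\<theta> z))\<^sup>2 / (4 * r))) \<partial>(\<mu> \<Otimes>\<^sub>M \<mu>))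
      = (\<integral>\<^sup>+x. \<integral>\<^sup>+y. ennreal (exp (- (dist x y)\<^sup>2 / (4 * r))) \<partial>\<mu> \<partial>\<mu>)"
    by (subst nn_integral_fst [symmetric]) (auto simp: \<theta>_def dist_norm)
  finally show ?thesis .
qed

subsection \<open>Fourier side of the Riesz energy\<close>

text \<open>The integral is Gamma(a) times \<open>s powr (- a)\<close>. A lower bound of the right
  order already comes from the window \<open>{1/s..2/s}\<close>, on which \<open>r * s\<close> stays
  between 1 and 2.\<close>

lemma powr_le_nn_integral_exp:
  fixes s a :: real
  assumes "s > 0" "0 < a" "a < 1"
  shows "ennreal (s powr (- a)) \<le> ennreal (exp 2 * 2 powr (1 - a)) *
     (\<integral>\<^sup>+r. ennreal (indicator {0<..} r * r powr (a - 1) * exp (- r * s)) \<partial>lborel)"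
proof -
  \<comment> \<open>A lower bound for the integrand on the window: \<open>r powr (a - 1)\<close>
    decreases, so it is smallest at \<open>2 / s\<close>, and the exponential is at least
    \<open>exp (- 2)\<close>.\<close>
  define k where "k = (2 / s) powr (a - 1) * exp (- 2)"
  have k: "k * indicator {1/s..2/s} r \<le> indicator {0<..} r * r powr (a - 1) * exp (- r * s)" for r
  proof (cases "r \<in> {1/s..2/s}")
    case True
    have "0 < 1 / s" using assms by simp
    also have "1 / s \<le> r" using True by simp
    finally have r: "r > 0" .
    have "(2 / s) powr (a - 1) \<le> r powr (a - 1)"
      using True r assms by (intro powr_mono2') auto
    moreover have "exp (- 2) \<le> exp (- r * s)"
      using True assms by (simp add: field_simps)
    ultimately show ?thesis
      using True r by (auto simp: k_def intro!: mult_mono)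
  qed auto
  have "ennreal (k * (1 / s)) = (\<integral>\<^sup>+r. ennreal (k * indicator {1/s..2/s} r) \<partial>lborel)"
  proof -
    have "(\<integral>\<^sup>+r. ennreal (k * indicator {1/s..2/s} r) \<partial>lborel) = (\<integral>\<^sup>+r. ennreal k * indicator {1/s..2/s} r \<partial>lborel)"
      by (intro nn_integral_cong) (auto simp: indicator_def)
    also have "\<dots> = ennreal k * ennreal (2 / s - 1 / s)"
      using assms by (subst nn_integral_cmult_indicator) (auto simp: divide_right_mono)
    also have "\<dots> = ennreal (k * (1 / s))"
      using assms by (simp add: diff_divide_distrib [symmetric] ennreal_mult k_def del: times_divide_eq_right)
    finally show ?thesis ..
  qed
  also have "\<dots> \<le> (\<integral>\<^sup>+r. ennreal (indicator {0<..} r * r powr (a - 1) * exp (- r * s)) \<partial>lborel)"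
    by (intro nn_integral_mono ennreal_leI k)
  finally have *: "ennreal (k * (1 / s)) \<le> (\<integral>\<^sup>+r. ennreal (indicator {0<..} r * r powr (a - 1) * exp (- r * s)) \<partial>lborel)" .
  have "s powr (- a) = exp 2 * 2 powr (1 - a) * (k * (1 / s))"
  proof -
    have "(2 / s) powr (a - 1) = s powr (1 - a) / 2 powr (1 - a)"
      using assms by (simp add: powr_divide powr_diff field_simps)
    moreover have "s powr (1 - a) = s * s powr (- a)"
      using assms by (simp add: powr_diff powr_minus field_simps)
    ultimately show ?thesis
      using assms by (simp add: k_def exp_minus)
  qed
  then have "ennreal (s powr (- a)) = ennreal (exp 2 * 2 powr (1 - a)) * ennreal (k * (1 / s))"
    using assms by (simp add: k_def flip: ennreal_mult)
  also have "\<dots> \<le> ennreal (exp 2 * 2 powr (1 - a)) *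
     (\<integral>\<^sup>+r. ennreal (indicator {0<..} r * r powr (a - 1) * exp (- r * s)) \<partial>lborel)"
    by (intro mult_left_mono *) auto
  finally show ?thesis .
qed

text \<open>Under \<open>r \<mapsto> 1 / r\<close> this is again a Gamma integral, of order
  \<open>D powr (a - 1)\<close>. The bound splits at \<open>r = D\<close>: below, the exponential
  tames the singularity at 0 and contributes the 2; above, it is at most 1 and the power tail
  contributes \<open>1 / (1 - a)\<close>.\<close>

lemma nn_integral_powr_exp_inverse_le:
  fixes D a :: real
  assumes "D > 0" "0 < a" "a < 1"
  shows "(\<integral>\<^sup>+r. ennreal (indicator {0<..} r * r powr (a - 2) * exp (- D / r)) \<partial>lborel)
     \<le> ennreal ((2 + 1 / (1 - a)) * D powr (a - 1))"
proof -
  have bound: "indicator {0<..} r * r powr (a - 2) * exp (- D / r)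
     \<le> 2 * D powr (a - 2) * indicator {0..D} r + r powr (a - 2) * indicator {D..} r" for r
  proof -
    consider "r \<le> 0" | "0 < r" "r \<le> D" | "D < r" by linarith
    then show ?thesis
    proof cases
      case 2
      \<comment> \<open>The quadratic Taylor term yields a factor of order the square of
        \<open>r / D\<close>, which lifts the non-integrable exponent \<open>a - 2\<close> to
        \<open>a > 0\<close>; the resulting increasing power is then bounded by its value at
        \<open>D\<close>.\<close>
      have "(D / r)\<^sup>2 / 2 \<le> exp (D / r)"
        using exp_lower_Taylor_quadratic [of "D / r"] divide_nonneg_pos [of D r] 2 assms by linarith
      then have "exp (- D / r) \<le> 2 * r\<^sup>2 / D\<^sup>2"
        using 2 assms by (simp add: exp_minus field_simps)
      then have "r powr (a - 2) * exp (- D / r) \<le> r powr (a - 2) * (2 * r powr 2 / D powr 2)"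
        using 2 assms by (intro mult_left_mono) auto
      also have "\<dots> = 2 * (r powr (a - 2) * r powr 2) / D powr 2"
        by simp
      also have "r powr (a - 2) * r powr 2 = r powr a"
        by (simp flip: powr_add)
      also have "2 * r powr a / D powr 2 \<le> 2 * D powr a / D powr 2"
        using 2 assms by (intro divide_right_mono mult_left_mono powr_mono2) auto
      also have "\<dots> = 2 * D powr (a - 2)"
        by (simp add: powr_diff)
      finally show ?thesis
        using 2 by (auto simp: indicator_def)
    next
      case 3
      then have "exp (- D / r) \<le> 1" using assms by simp
      then have "r powr (a - 2) * exp (- D / r) \<le> r powr (a - 2)"
        by (intro mult_left_le) auto
      then show ?thesis
        using 3 assms by (auto simp: indicator_def)
    qed (auto simp: indicator_def)
  qed
  \<comment> \<open>The antiderivative vanishes at infinity because \<open>a < 1\<close>, which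
    leaves only its value at \<open>D\<close>.\<close>
  have tail: "(\<integral>\<^sup>+r. ennreal (r powr (a - 2)) * indicator {D..} r \<partial>lborel) = ennreal (0 - (- (D powr (a - 1) / (1 - a))))"
  proof (rule nn_integral_FTC_atLeast)
    show "((\<lambda>r. - (r powr (a - 1) / (1 - a))) has_real_derivative r powr (a - 2)) (at r)" if "D \<le> r" for r
    proof -
      have "((\<lambda>r. - (r powr (a - 1) / (1 - a))) has_real_derivative - ((a - 1) * r powr (a - 1 - 1) / (1 - a))) (at r)"
        using that assms by (intro DERIV_minus DERIV_cdivide has_real_derivative_powr) auto
      moreover have "(a - 1) * r powr (a - 1 - 1) = - ((1 - a) * r powr (a - 2))"
        by (simp add: algebra_simps)
      ultimately show ?thesis using assms by simp
    qed
    show "((\<lambda>r. - (r powr (a - 1) / (1 - a))) \<longlongrightarrow> 0) at_top"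
    proof -
      have "((\<lambda>r. - (r powr (a - 1) / (1 - a))) \<longlongrightarrow> - (0 / (1 - a))) at_top"
        using assms by (intro tendsto_intros tendsto_neg_powr filterlim_ident) auto
      then show ?thesis by simp
    qed
  qed auto
  have "(\<integral>\<^sup>+r. ennreal (indicator {0<..} r * r powr (a - 2) * exp (- D / r)) \<partial>lborel)
     \<le> (\<integral>\<^sup>+r. ennreal (2 * D powr (a - 2)) * indicator {0..D} r + ennreal (r powr (a - 2)) * indicator {D..} r \<partial>lborel)"
    using bound by (intro nn_integral_mono)
     (auto simp: ennreal_indicator [symmetric] simp flip: ennreal_mult ennreal_plus intro!: ennreal_leI)
  also have "\<dots> = ennreal (2 * D powr (a - 2)) * ennreal D + ennreal (D powr (a - 1) / (1 - a))"
    using assms tail by (subst nn_integral_add) (auto simp: nn_integral_cmult)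
  also have "\<dots> = ennreal (2 * (D powr (a - 2) * D) + D powr (a - 1) / (1 - a))"
    using assms by (simp add: mult.assoc flip: ennreal_mult ennreal_plus)
  also have "D powr (a - 2) * D = D powr (a - 1)"
    using assms powr_mult_base [of D "a - 2"] by (simp add: mult.commute)
  finally show ?thesis
    by (simp add: distrib_right)
qed

text \<open>Gaussians \<open>exp (- r * (norm \<xi>)\<^sup>2)\<close> with weight
  \<open>r powr (a - 1)\<close> dominate the Fourier weight. For each \<open>r\<close> the Gaussian
  identity passes to the double integral over \<open>\<mu>\<close>, and integrating over
  \<open>r\<close> there returns a multiple of the Riesz kernel.\<close>

lemma fourier_energy_le_riesz_energy:
  fixes \<omega> :: real
  assumes \<omega>: "0 < \<omega>" "\<omega> < 2"
  shows "\<exists>C\<ge>0. \<forall>\<mu> :: (real \<times> real) measure. finite_borel_measure \<mu> \<longrightarrow>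
    (\<integral>\<^sup>+\<xi>. ennreal ((norm (fourier_measure \<mu> \<xi>))\<^sup>2 * norm \<xi> powr (\<omega> - 2)) \<partial>lborel)
      \<le> ennreal C * riesz_energy \<omega> \<mu>"
proof (intro exI conjI allI impI)
  \<comment> \<open>Then \<open>\<omega> - 2 = - 2 * a\<close> and
    \<open>- \<omega> = 2 * (a - 1)\<close>, so both weights are powers of squared lengths, with
    exponents \<open>- a\<close> and \<open>a - 1\<close>; \<open>0 < \<omega> < 2\<close> amounts
    to \<open>0 < a < 1\<close>.\<close>
  define a where "a = 1 - \<omega> / 2"
  have a: "0 < a" "a < 1" using \<omega> by (auto simp: a_def)
  define c1 where "c1 = exp 2 * 2 powr (1 - a)"
  define c2 where "c2 = (2 + 1 / (1 - a)) * (1/4) powr (a - 1)"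
  have c: "c1 \<ge> 0" "c2 \<ge> 0" using a by (auto simp: c1_def c2_def)
  show "c1 * pi * c2 \<ge> 0" using c by simp
  fix \<mu> :: "(real \<times> real) measure"
  assume \<mu>: "finite_borel_measure \<mu>"
  have [measurable_cong]: "sets \<mu> = sets borel" and "finite_measure \<mu>"
    using \<mu> by (auto simp: finite_borel_measure_def)
  interpret finite_measure \<mu> by fact
  interpret Q: pair_sigma_finite "lborel :: real measure" \<mu> ..
  note [measurable] = fourier_measure_borel_measurable [OF \<mu>]
  let ?F = "\<lambda>\<xi>. (norm (fourier_measure \<mu> \<xi>))\<^sup>2"
  let ?w = "\<lambda>b r. indicator {0<..} r * r powr b :: real"
  have 1: "ennreal (?F \<xi> * norm \<xi> powr (\<omega> - 2)) \<le>
     ennreal c1 * (\<integral>\<^sup>+r. ennreal (?w (a - 1) r) * ennreal (exp (- r * (norm \<xi>)\<^sup>2) * ?F \<xi>) \<partial>lborel)" for \<xi>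
  \<comment> \<open>At the origin \<open>0 powr (\<omega> - 2) = 0\<close>, so the left side
    vanishes.\<close>
  proof (cases "\<xi> = 0")
    case False
    then have "norm \<xi> powr (\<omega> - 2) = ((norm \<xi>)\<^sup>2) powr (- a)"
      by (simp add: a_def powr_powr flip: powr_numeral)
    then have "ennreal (?F \<xi> * norm \<xi> powr (\<omega> - 2)) = ennreal (?F \<xi>) * ennreal (((norm \<xi>)\<^sup>2) powr (- a))"
      by (simp add: ennreal_mult)
    also have "\<dots> \<le> ennreal (?F \<xi>) * (ennreal c1 * (\<integral>\<^sup>+r. ennreal (?w (a - 1) r * exp (- r * (norm \<xi>)\<^sup>2)) \<partial>lborel))"
      unfolding c1_def using False a by (intro mult_left_mono powr_le_nn_integral_exp) auto
    also have "\<dots> = ennreal c1 * (\<integral>\<^sup>+r. ennreal (?F \<xi>) * ennreal (?w (a - 1) r * exp (- r * (norm \<xi>)\<^sup>2)) \<partial>lborel)"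
      by (subst nn_integral_cmult) (auto simp: mult_ac)
    also have "(\<integral>\<^sup>+r. ennreal (?F \<xi>) * ennreal (?w (a - 1) r * exp (- r * (norm \<xi>)\<^sup>2)) \<partial>lborel)
       = (\<integral>\<^sup>+r. ennreal (?w (a - 1) r) * ennreal (exp (- r * (norm \<xi>)\<^sup>2) * ?F \<xi>) \<partial>lborel)"
      by (intro nn_integral_cong) (simp add: mult_ac flip: ennreal_mult)
    finally show ?thesis .
  qed simp
  \<comment> \<open>The normalisation \<open>pi / r\<close> of the Gaussian identity lowers the
    exponent of the weight from \<open>a - 1\<close> to \<open>a - 2\<close>. For
    \<open>r \<le> 0\<close> both sides are 0.\<close>
  have 2: "ennreal (?w (a - 1) r) * (\<integral>\<^sup>+\<xi>. ennreal (exp (- r * (norm \<xi>)\<^sup>2) * ?F \<xi>) \<partial>lborel)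
     = ennreal pi * (\<integral>\<^sup>+x. \<integral>\<^sup>+y. ennreal (?w (a - 2) r * exp (- ((dist x y)\<^sup>2 / 4) / r)) \<partial>\<mu> \<partial>\<mu>)" for r
  proof (cases "r > 0")
    case True
    have "r powr (a - 1) * (pi / r) = pi * r powr (a - 2)"
      using powr_mult_base [of r "a - 2"] True by (simp add: field_simps)
    then have "ennreal (r powr (a - 1)) * ennreal (pi / r) = ennreal pi * ennreal (r powr (a - 2))"
      using True by (metis ennreal_mult divide_nonneg_pos pi_ge_zero powr_ge_zero)
    moreover have "(\<integral>\<^sup>+x. \<integral>\<^sup>+y. ennreal (?w (a - 2) r * exp (- ((dist x y)\<^sup>2 / 4) / r)) \<partial>\<mu> \<partial>\<mu>)
       = ennreal (r powr (a - 2)) * (\<integral>\<^sup>+x. \<integral>\<^sup>+y. ennreal (exp (- (dist x y)\<^sup>2 / (4 * r))) \<partial>\<mu> \<partial>\<mu>)"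
      using True by (simp add: ennreal_mult nn_integral_cmult)
    ultimately show ?thesis
      using True by (simp add: gaussian_weighted_fourier_square [OF \<mu> True, simplified] mult.assoc [symmetric])
  qed simp
  have 3: "(\<integral>\<^sup>+r. ennreal (?w (a - 2) r * exp (- ((dist x y)\<^sup>2 / 4) / r)) \<partial>lborel)
     \<le> ennreal c2 * riesz_kernel \<omega> x y" for x y :: "real \<times> real"
  proof (cases "x = y")
    case False
    have "(dist x y)\<^sup>2 powr (a - 1) = dist x y powr (- \<omega>)"
      using False by (simp add: a_def powr_powr flip: powr_numeral)
    then have "(2 + 1 / (1 - a)) * ((dist x y)\<^sup>2 / 4) powr (a - 1) = c2 * dist x y powr (- \<omega>)"
      using powr_mult [of "1/4" "(dist x y)\<^sup>2" "a - 1"] by (simp add: c2_def)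
    moreover have "(\<integral>\<^sup>+r. ennreal (?w (a - 2) r * exp (- ((dist x y)\<^sup>2 / 4) / r)) \<partial>lborel)
       \<le> ennreal ((2 + 1 / (1 - a)) * ((dist x y)\<^sup>2 / 4) powr (a - 1))"
      using False a by (intro nn_integral_powr_exp_inverse_le) auto
    ultimately show ?thesis
      using False c by (simp add: riesz_kernel_def ennreal_mult)
  next
    case True
    \<comment> \<open>On the diagonal the kernel is infinite; strict positivity of \<open>c2\<close>
      keeps the right side infinite, since \<open>0 * \<infinity> = 0\<close>.\<close>
    have "c2 > 0" using a by (auto simp: c2_def intro!: mult_pos_pos add_pos_pos)
    then show ?thesis using True by (simp add: riesz_kernel_def ennreal_mult_top)
  qed
  have "(\<integral>\<^sup>+\<xi>. ennreal (?F \<xi> * norm \<xi> powr (\<omega> - 2)) \<partial>lborel)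
     \<le> (\<integral>\<^sup>+\<xi>. ennreal c1 * (\<integral>\<^sup>+r. ennreal (?w (a - 1) r) * ennreal (exp (- r * (norm \<xi>)\<^sup>2) * ?F \<xi>) \<partial>lborel) \<partial>lborel)"
    by (intro nn_integral_mono 1)
  also have "\<dots> = ennreal c1 * (\<integral>\<^sup>+\<xi>. \<integral>\<^sup>+r. ennreal (?w (a - 1) r) * ennreal (exp (- r * (norm \<xi>)\<^sup>2) * ?F \<xi>) \<partial>lborel \<partial>lborel)"
    by (intro nn_integral_cmult) measurable
  \<comment> \<open>Tonelli takes the integral over \<open>r\<close> outside, where the identity for
    fixed \<open>r\<close> applies; two further exchanges bring it back inside, where it is
    estimated for fixed \<open>x\<close> and \<open>y\<close>.\<close>
  also have "(\<integral>\<^sup>+\<xi>. \<integral>\<^sup>+r. ennreal (?w (a - 1) r) * ennreal (exp (- r * (norm \<xi>)\<^sup>2) * ?F \<xi>) \<partial>lborel \<partial>lborel)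
     = (\<integral>\<^sup>+r. \<integral>\<^sup>+\<xi>. ennreal (?w (a - 1) r) * ennreal (exp (- r * (norm \<xi>)\<^sup>2) * ?F \<xi>) \<partial>lborel \<partial>lborel)"
    by (intro lborel_pair.Fubini') measurable
  also have "\<dots> = (\<integral>\<^sup>+r. ennreal (?w (a - 1) r) * (\<integral>\<^sup>+\<xi>. ennreal (exp (- r * (norm \<xi>)\<^sup>2) * ?F \<xi>) \<partial>lborel) \<partial>lborel)"
    by (intro nn_integral_cong nn_integral_cmult) measurable
  also have "\<dots> = (\<integral>\<^sup>+r. ennreal pi * (\<integral>\<^sup>+x. \<integral>\<^sup>+y. ennreal (?w (a - 2) r * exp (- ((dist x y)\<^sup>2 / 4) / r)) \<partial>\<mu> \<partial>\<mu>) \<partial>lborel)"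
    by (simp only: 2)
  also have "\<dots> = ennreal pi * (\<integral>\<^sup>+r. \<integral>\<^sup>+x. \<integral>\<^sup>+y. ennreal (?w (a - 2) r * exp (- ((dist x y)\<^sup>2 / 4) / r)) \<partial>\<mu> \<partial>\<mu> \<partial>lborel)"
    by (intro nn_integral_cmult) measurable
  also have "(\<integral>\<^sup>+r. \<integral>\<^sup>+x. \<integral>\<^sup>+y. ennreal (?w (a - 2) r * exp (- ((dist x y)\<^sup>2 / 4) / r)) \<partial>\<mu> \<partial>\<mu> \<partial>lborel)
      = (\<integral>\<^sup>+x. \<integral>\<^sup>+r. \<integral>\<^sup>+y. ennreal (?w (a - 2) r * exp (- ((dist x y)\<^sup>2 / 4) / r)) \<partial>\<mu> \<partial>lborel \<partial>\<mu>)"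
    by (intro Q.Fubini' [symmetric]) measurable
  also have "\<dots> = (\<integral>\<^sup>+x. \<integral>\<^sup>+y. \<integral>\<^sup>+r. ennreal (?w (a - 2) r * exp (- ((dist x y)\<^sup>2 / 4) / r)) \<partial>lborel \<partial>\<mu> \<partial>\<mu>)"
    by (intro nn_integral_cong Q.Fubini' [symmetric]) measurable
  also have "\<dots> \<le> (\<integral>\<^sup>+x. \<integral>\<^sup>+y. ennreal c2 * riesz_kernel \<omega> x y \<partial>\<mu> \<partial>\<mu>)"
    by (intro nn_integral_mono 3)
  also have "\<dots> = ennreal c2 * riesz_energy \<omega> \<mu>"
  proof -
    have m: "case_prod (riesz_kernel \<omega>) \<in> borel_measurable (\<mu> \<Otimes>\<^sub>M \<mu>)"
      unfolding riesz_kernel_def by measurable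
    have "riesz_kernel \<omega> x \<in> borel_measurable \<mu>" for x
      unfolding riesz_kernel_def by measurable
    moreover have "(\<lambda>x. \<integral>\<^sup>+y. riesz_kernel \<omega> x y \<partial>\<mu>) \<in> borel_measurable \<mu>"
      using borel_measurable_nn_integral_fst [OF m] by simp
    ultimately show ?thesis
      unfolding riesz_energy_def by (simp add: nn_integral_cmult)
  qed
  finally show "(\<integral>\<^sup>+\<xi>. ennreal (?F \<xi> * norm \<xi> powr (\<omega> - 2)) \<partial>lborel) \<le> ennreal (c1 * pi * c2) * riesz_energy \<omega> \<mu>"
    using c by (simp add: ennreal_mult mult_left_mono mult.assoc)
qed

subsection \<open>Van der Corput estimates\<close>

text \<open>Integration by parts: \<open>cis f\<close> is the derivative of
  \<open>- \<i> * cis f / f'\<close> minus a remainder of modulus \<open>f'' / (f')\<^sup>2\<close>.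
  The two boundary terms and the remainder contribute \<open>1 / l\<close>, \<open>1 / l\<close> and
  \<open>2 / l\<close>.\<close>

lemma van_der_Corput_first:
  fixes f f' f'' :: "real \<Rightarrow> real"
  assumes "a \<le> b" "l > 0"
    and f: "\<And>x. (f has_real_derivative f' x) (at x)"
    and f': "\<And>x. (f' has_real_derivative f'' x) (at x)"
    and cont: "continuous_on {a..b} f''"
    and nonneg: "\<And>x. x \<in> {a..b} \<Longrightarrow> f'' x \<ge> 0"
    and lower: "\<And>x. x \<in> {a..b} \<Longrightarrow> \<bar>f' x\<bar> \<ge> l"
  shows "norm (integral {a..b} (\<lambda>x. cis (f x))) \<le> 4 / l"
proof -
  have nz: "f' x \<noteq> 0" if "x \<in> {a..b}" for x
    using lower [OF that] \<open>l > 0\<close> by auto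
  have cf: "continuous_on A f" and cf': "continuous_on A f'" for A
    using f f' by (meson DERIV_continuous_on has_field_derivative_at_within)+
  define F where "F x = - \<i> * cis (f x) * of_real (inverse (f' x))" for x
  define G where "G x = \<i> * cis (f x) * of_real (f'' x / (f' x)\<^sup>2)" for x
  have dF: "(F has_vector_derivative (cis (f x) + G x)) (at x within {a..b})" if x: "x \<in> {a..b}" for x
  proof -
    have 1: "((\<lambda>x. cis (f x)) has_vector_derivative of_real (f' x) * (\<i> * cis (f x))) (at x within {a..b})"
    proof -
      have "(f has_derivative (\<lambda>t. f' x * t)) (at x within {a..b})"
        using f has_derivative_at_withinI unfolding has_field_derivative_def by blast
      then have "((\<lambda>x. cis (f x)) has_derivative (\<lambda>t. (f' x * t) *\<^sub>R (\<i> * cis (f x)))) (at x within {a..b})"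
        by (rule has_derivative_cis)
      then show ?thesis
        by (simp add: has_vector_derivative_def scaleR_conv_of_real mult_ac)
    qed
    have "((\<lambda>x. inverse (f' x)) has_real_derivative - (f'' x / (f' x)\<^sup>2)) (at x within {a..b})"
      using nz [OF x] by (auto intro!: derivative_eq_intros has_field_derivative_at_within [OF f']
         simp: power2_eq_square field_simps)
    then have 2: "((\<lambda>x. of_real (inverse (f' x)) :: complex) has_vector_derivative of_real (- (f'' x / (f' x)\<^sup>2))) (at x within {a..b})"
      by (intro has_vector_derivative_of_real) (simp add: has_real_derivative_iff_has_vector_derivative)
    show ?thesis
      unfolding F_def
      by (rule has_vector_derivative_eq_rhs, rule has_vector_derivative_mult,
          rule has_vector_derivative_mult_right, rule 1, rule 2)
        (use nz [OF x] in \<open>simp add: G_def field_simps\<close>)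
  qed
  have "((\<lambda>x. cis (f x) + G x) has_integral (F b - F a)) {a..b}"
    by (intro fundamental_theorem_of_calculus dF) fact+
  moreover have contG: "continuous_on {a..b} G"
    unfolding G_def using nz by (intro continuous_intros cf cf' cont) auto
  then have intG: "G integrable_on {a..b}"
    by (rule integrable_continuous_real)
  ultimately have "((\<lambda>x. cis (f x) + G x - G x) has_integral (F b - F a - integral {a..b} G)) {a..b}"
    by (intro has_integral_diff integrable_integral)
  then have eq: "integral {a..b} (\<lambda>x. cis (f x)) = F b - F a - integral {a..b} G"
    by (simp add: integral_unique)
  have nF: "norm (F x) \<le> 1 / l" if "x \<in> {a..b}" for x
    using lower [OF that] \<open>l > 0\<close> by (simp add: F_def norm_mult norm_inverse divide_inverse le_imp_inverse_le)
  have H: "((\<lambda>x. f'' x / (f' x)\<^sup>2) has_integral (- inverse (f' b) - (- inverse (f' a)))) {a..b}"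
  proof (intro fundamental_theorem_of_calculus \<open>a \<le> b\<close>)
    fix x assume "x \<in> {a..b}"
    then show "((\<lambda>x. - inverse (f' x)) has_vector_derivative f'' x / (f' x)\<^sup>2) (at x within {a..b})"
      unfolding has_real_derivative_iff_has_vector_derivative [symmetric]
      using nz by (auto intro!: derivative_eq_intros has_field_derivative_at_within [OF f']
         simp: power2_eq_square field_simps)
  qed
  \<comment> \<open>Since \<open>f'' \<ge> 0\<close>, the modulus of \<open>G\<close> is exactly the
    derivative of \<open>- inverse (f' x)\<close>, so its integral telescopes to endpoint values and
    is independent of the interval length.\<close>
  have "norm (integral {a..b} G) \<le> integral {a..b} (\<lambda>x. f'' x / (f' x)\<^sup>2)"
    using H intG nonneg by (intro integral_norm_bound_integral) (auto simp: G_def norm_mult norm_divide norm_power)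
  also have "\<dots> = inverse (f' a) - inverse (f' b)"
    using H by (simp add: integral_unique)
  also have "\<dots> \<le> \<bar>inverse (f' a)\<bar> + \<bar>inverse (f' b)\<bar>"
    by linarith
  also have "\<dots> \<le> inverse l + inverse l"
    unfolding abs_inverse using \<open>a \<le> b\<close> \<open>l > 0\<close> by (intro add_mono le_imp_inverse_le lower) auto
  finally have nG: "norm (integral {a..b} G) \<le> 2 / l"
    by (simp add: divide_inverse)
  have "norm (F b - F a - integral {a..b} G) \<le> norm (F b) + norm (F a) + norm (integral {a..b} G)"
    by (meson norm_triangle_ineq4 order.trans add_right_mono)
  also have "\<dots> \<le> 1 / l + 1 / l + 2 / l"
    using \<open>a \<le> b\<close> by (intro add_mono nF nG) auto
  finally show ?thesis
    by (simp add: eq)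
qed

text \<open>As \<open>f'\<close> grows at rate at least \<open>l\<close>, it has modulus at least
  \<open>sqrt l\<close> outside a window of half-width \<open>1 / sqrt l\<close>. The window is
  bounded by its length, at most \<open>2 / sqrt l\<close>, and each side by the first-derivative
  estimate, \<open>4 / sqrt l\<close>.\<close>

lemma van_der_Corput_second:
  fixes f f' f'' :: "real \<Rightarrow> real"
  assumes "a \<le> b" "l > 0"
    and f: "\<And>x. (f has_real_derivative f' x) (at x)"
    and f': "\<And>x. (f' has_real_derivative f'' x) (at x)"
    and cont: "continuous_on {a..b} f''"
    and lower: "\<And>x. x \<in> {a..b} \<Longrightarrow> f'' x \<ge> l"
  shows "norm (integral {a..b} (\<lambda>x. cis (f x))) \<le> 10 / sqrt l"
proof -
  have cf: "continuous_on A f" and cf': "continuous_on A f'" for A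
    using f f' by (meson DERIV_continuous_on has_field_derivative_at_within)+
  have growth: "f' y - f' x \<ge> l * (y - x)" if "a \<le> x" "x \<le> y" "y \<le> b" for x y
  proof (cases "x = y")
    case False
    then have "x < y" using that by simp
    then obtain z where "x < z" "z < y" "f' y - f' x = (y - x) * f'' z"
      using MVT2 [of x y f' f''] f' by blast
    moreover have "(y - x) * l \<le> (y - x) * f'' z"
      using that \<open>x < z\<close> \<open>z < y\<close> by (intro mult_left_mono lower) auto
    ultimately show ?thesis
      by (simp add: mult.commute)
  qed simp
  \<comment> \<open>The centre is a zero of \<open>f'\<close>, or the endpoint nearest to one if
    \<open>f'\<close> keeps its sign. The guards \<open>a < c\<close> and \<open>c < b\<close> let
    one statement cover all cases.\<close>
  obtain c where c: "a \<le> c" "c \<le> b" "a < c \<Longrightarrow> f' c \<le> 0" "c < b \<Longrightarrow> f' c \<ge> 0"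
  proof -
    consider "f' a \<ge> 0" | "f' b \<le> 0" | "f' a \<le> 0" "f' b \<ge> 0" by linarith
    then show ?thesis
    proof cases
      case 3
      then obtain c where "a \<le> c" "c \<le> b" "f' c = 0"
        using IVT' [of f' a 0 b] \<open>a \<le> b\<close> cf' by auto
      then show ?thesis using that by auto
    qed (use that \<open>a \<le> b\<close> in auto)
  qed
  \<comment> \<open>This width balances the trivial bound on the window against the bound
    \<open>4 / (l * h)\<close> outside it.\<close>
  define h where "h = 1 / sqrt l"
  have h: "h > 0" "l * h = sqrt l" "4 / sqrt l = 4 * h"
    using \<open>l > 0\<close> by (auto simp: h_def field_simps)
  \<comment> \<open>The window is clipped to \<open>{a..b}\<close>; a side that is clipped becomes a
    degenerate interval with zero integral.\<close>
  define u where "u = max a (c - h)"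
  define v where "v = min b (c + h)"
  have uv: "a \<le> u" "u \<le> v" "v \<le> b"
    using c h by (auto simp: u_def v_def)
  have int: "(\<lambda>x. cis (f x)) integrable_on {x..y}" for x y
    by (intro integrable_continuous_real continuous_intros cf)
  have left: "norm (integral {a..u} (\<lambda>x. cis (f x))) \<le> 4 * h"
  proof (cases "u = a")
    case False
    then have u: "u = c - h" "a < c" using h c by (auto simp: u_def)
    have "f' x \<le> - sqrt l" if "x \<in> {a..u}" for x
    proof -
      have "l * h \<le> l * (c - x)"
        using that u \<open>l > 0\<close> by (intro mult_left_mono) auto
      also have "\<dots> \<le> f' c - f' x"
        using that u uv c h by (intro growth) auto
      finally show ?thesis using c(3) u h by simp
    qed
    then have "norm (integral {a..u} (\<lambda>x. cis (f x))) \<le> 4 / sqrt l"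
      using lower uv \<open>l > 0\<close> by (intro van_der_Corput_first [OF _ _ f f'] continuous_on_subset [OF cont])
        (force intro: order.trans [of 0 l])+
    then show ?thesis using h by simp
  qed (use h in simp)
  have right: "norm (integral {v..b} (\<lambda>x. cis (f x))) \<le> 4 * h"
  proof (cases "v = b")
    case False
    then have v: "v = c + h" "c < b" using h c by (auto simp: v_def)
    have "f' x \<ge> sqrt l" if "x \<in> {v..b}" for x
    proof -
      have "l * h \<le> l * (x - c)"
        using that v \<open>l > 0\<close> by (intro mult_left_mono) auto
      also have "\<dots> \<le> f' x - f' c"
        using that v uv c h by (intro growth) auto
      finally show ?thesis using c(4) v h by simp
    qed
    then have "norm (integral {v..b} (\<lambda>x. cis (f x))) \<le> 4 / sqrt l"
      using lower uv \<open>l > 0\<close> by (intro van_der_Corput_first [OF _ _ f f'] continuous_on_subset [OF cont])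
        (force intro: order.trans [of 0 l])+
    then show ?thesis using h by simp
  qed (use h in simp)
  have "norm (integral {u..v} (\<lambda>x. cis (f x))) \<le> 1 * (v - u)"
    using uv by (intro integral_bound continuous_intros cf) auto
  also have "\<dots> \<le> 2 * h"
    by (simp add: u_def v_def)
  finally have mid: "norm (integral {u..v} (\<lambda>x. cis (f x))) \<le> 2 * h" .
  have "integral {a..b} (\<lambda>x. cis (f x)) =
     integral {a..u} (\<lambda>x. cis (f x)) + integral {u..v} (\<lambda>x. cis (f x)) + integral {v..b} (\<lambda>x. cis (f x))"
    using uv by (simp add: Henstock_Kurzweil_Integration.integral_combine int)
  also have "norm \<dots> \<le> 4 * h + 2 * h + 4 * h"
    by (intro norm_triangle_le add_mono left mid right)
  finally show ?thesis by (simp add: h_def)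
qed

lemma norm_integral_cis_uminus:
  "norm (integral S (\<lambda>x. cis (- f x))) = norm (integral S (\<lambda>x. cis (f x)))"
proof -
  have "(\<lambda>x. cis (- f x)) = (\<lambda>x. cnj (cis (f x)))"
    by (simp add: cis_cnj)
  then show ?thesis
    by (simp add: Henstock_Kurzweil_Integration.integral_cnj [symmetric])
qed

text \<open>For \<xi> = (u, v) the phase is \<open>u * x + v * \<psi> x\<close>. If \<open>u\<close>
  dominates, its first derivative has size comparable to \<open>norm \<xi>\<close>; otherwise
  \<open>v\<close> is comparable to \<open>norm \<xi>\<close> and convexity bounds the second
  derivative from below. Negative \<open>v\<close> reduces to positive \<open>v\<close> by
  conjugation.\<close>

lemma curve_fourier_decay:
  fixes \<psi> \<psi>' \<psi>'' :: "real \<Rightarrow> real"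
  assumes \<psi>: "\<And>x. (\<psi> has_real_derivative \<psi>' x) (at x)"
    and \<psi>': "\<And>x. (\<psi>' has_real_derivative \<psi>'' x) (at x)"
    and cont: "continuous_on {-1..1} \<psi>''"
    and pos: "\<And>x. \<psi>'' x > 0"
  shows "\<exists>C\<ge>0. \<forall>\<xi>. \<xi> \<noteq> 0 \<longrightarrow>
    norm (integral {-1..1} (\<lambda>x. cis ((x, \<psi> x) \<bullet> \<xi>))) \<le> C * norm \<xi> powr (-1/2)"
proof -
  have c\<psi>: "continuous_on A \<psi>" and c\<psi>': "continuous_on A \<psi>'" for A
    using \<psi> \<psi>' by (meson DERIV_continuous_on has_field_derivative_at_within)+
  obtain x0 where x0: "\<And>x. x \<in> {-1..1} \<Longrightarrow> \<psi>'' x0 \<le> \<psi>'' x"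
    using continuous_attains_inf [OF compact_Icc _ cont] by fastforce
  \<comment> \<open>The minimum of \<open>\<psi>''\<close> over the compact interval, hence
    positive.\<close>
  define m where "m = \<psi>'' x0"
  have m: "m > 0" "\<And>x. x \<in> {-1..1} \<Longrightarrow> m \<le> \<psi>'' x"
    using x0 pos by (auto simp: m_def)
  have "bounded (\<psi>' ` {-1..1})"
    by (intro compact_imp_bounded compact_continuous_image c\<psi>' compact_Icc)
  then obtain K where K0: "\<And>x. x \<in> {-1..1} \<Longrightarrow> \<bar>\<psi>' x\<bar> \<le> K"
    by (fastforce simp: bounded_iff)
  \<comment> \<open>Taking \<open>L\<close> at least 1 gives \<open>v \<le> L * v\<close>, so that
    \<open>\<bar>u\<bar> \<ge> 2 * L * v\<close> also makes \<open>v\<close> at most half of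
    \<open>\<bar>u\<bar>\<close>.\<close>
  define L where "L = max K 1"
  have L: "L \<ge> 1" "\<And>x. x \<in> {-1..1} \<Longrightarrow> \<bar>\<psi>' x\<bar> \<le> L"
    using K0 by (auto simp: L_def le_max_iff_disj)
  \<comment> \<open>The two entries are the constants of the first-derivative and the
    second-derivative case.\<close>
  define C where "C = max 5 (10 * sqrt ((2 * L + 1) / m))"
  have main: "norm (integral {-1..1} (\<lambda>x. cis (u * x + v * \<psi> x))) \<le> C / sqrt (norm (u, v))"
    if v: "v \<ge> 0" and nz: "(u, v) \<noteq> 0" for u v :: real
  proof -
    define n where "n = norm (u, v)"
    have n: "n > 0" "n \<le> \<bar>u\<bar> + v"
      using nz v norm_Pair_le [of u v] by (auto simp: n_def)
    have d1: "((\<lambda>x. u * x + v * \<psi> x) has_real_derivative u + v * \<psi>' x) (at x)" for x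
      by (auto intro!: derivative_eq_intros \<psi>)
    have d2: "((\<lambda>x. u + v * \<psi>' x) has_real_derivative v * \<psi>'' x) (at x)" for x
      by (auto intro!: derivative_eq_intros \<psi>')
    have c2: "continuous_on {-1..1} (\<lambda>x. v * \<psi>'' x)"
      by (intro continuous_intros cont)
    let ?I = "norm (integral {-1..1} (\<lambda>x. cis (u * x + v * \<psi> x)))"
    show ?thesis
    proof (cases "\<bar>u\<bar> \<ge> 2 * L * v")
      case True
      have "v \<le> L * v" using mult_right_mono [OF L(1) v] by simp
      then have nu: "n \<le> 3 / 2 * \<bar>u\<bar>" using n(2) True by linarith
      \<comment> \<open>The curve term is at most half of \<open>\<bar>u\<bar>\<close>, which leaves
        at least half of \<open>\<bar>u\<bar>\<close>, and this is at least
        \<open>n / 3\<close>.\<close>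
      have low: "\<bar>u + v * \<psi>' x\<bar> \<ge> n / 3" if "x \<in> {-1..1}" for x
      proof -
        have "\<bar>v * \<psi>' x\<bar> \<le> L * v"
          using mult_right_mono [OF L(2) [OF that] v] v by (simp add: abs_mult mult.commute)
        then show ?thesis using nu True by linarith
      qed
      have "?I \<le> 4 / (n / 3)"
        using v low n less_imp_le [OF pos] by (intro van_der_Corput_first [OF _ _ d1 d2 c2]) auto
      \<comment> \<open>The bound \<open>12 / n\<close> is too weak for small \<open>n\<close>, so
        it is multiplied with the trivial bound 2: the square of the integral is at most
        \<open>24 / n\<close>, below \<open>25 / n\<close>, for every \<open>n\<close>.\<close>
      moreover have "?I \<le> 1 * (1 - (-1))"
        by (intro integral_bound continuous_intros c\<psi>) auto
      ultimately have "?I * ?I \<le> 2 * (4 / (n / 3))"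
        by (intro mult_mono) auto
      also have "\<dots> \<le> (5 / sqrt n)\<^sup>2"
        using n by (simp add: power_divide field_simps)
      finally have "?I \<le> 5 / sqrt n"
        using n by (intro power2_le_imp_le [of ?I]) (auto simp: power2_eq_square)
      also have "\<dots> \<le> C / sqrt n"
        using n by (intro divide_right_mono) (auto simp: C_def)
      finally show ?thesis by (simp add: n_def)
    next
      case False
      then have nv: "n \<le> (2 * L + 1) * v" using n by (simp add: algebra_simps)
      then have vp: "v > 0" using v n L by (cases "v = 0") auto
      have "?I \<le> 10 / sqrt (m * v)"
        using m vp by (intro van_der_Corput_second [OF _ _ d1 d2 c2]) (auto simp: mult.commute)
      also have "\<dots> \<le> 10 / sqrt (m * (n / (2 * L + 1)))"
        using n m vp nv L by (intro divide_left_mono real_sqrt_le_mono mult_left_mono mult_pos_pos) (auto simp: field_simps)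
      also have "\<dots> = 10 * sqrt ((2 * L + 1) / m) / sqrt n"
        using n m L by (simp add: real_sqrt_divide real_sqrt_mult)
      also have "\<dots> \<le> C / sqrt n"
        using n by (intro divide_right_mono) (auto simp: C_def)
      finally show ?thesis by (simp add: n_def)
    qed
  qed
  show ?thesis
  proof (intro exI conjI allI impI)
    show "C \<ge> 0" by (simp add: C_def)
    fix \<xi> :: "real \<times> real" assume "\<xi> \<noteq> 0"
    obtain u v where \<xi>: "\<xi> = (u, v)" by (cases \<xi>)
    have "norm (integral {-1..1} (\<lambda>x. cis (u * x + v * \<psi> x))) \<le> C / sqrt (norm (u, v))"
    proof (cases "v \<ge> 0")
      case True
      then show ?thesis using main \<open>\<xi> \<noteq> 0\<close> \<xi> by auto
    next
      case False
      \<comment> \<open>Replacing \<xi> by its negative conjugates the integral and preserves both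
        norms.\<close>
      have "norm (integral {-1..1} (\<lambda>x. cis (- u * x + - v * \<psi> x))) \<le> C / sqrt (norm (- u, - v))"
        using False by (intro main) (auto simp: zero_prod_def)
      also have "norm (- u, - v) = norm (u, v)"
        by (simp add: norm_Pair)
      also have "norm (integral {-1..1} (\<lambda>x. cis (- u * x + - v * \<psi> x))) =
         norm (integral {-1..1} (\<lambda>x. cis (u * x + v * \<psi> x)))"
        using norm_integral_cis_uminus [of "{-1..1}" "\<lambda>x. u * x + v * \<psi> x"] by simp
      finally show ?thesis .
    qed
    then show "norm (integral {-1..1} (\<lambda>x. cis ((x, \<psi> x) \<bullet> \<xi>))) \<le> C * norm \<xi> powr (-1/2)"
      by (simp add: \<xi> mult.commute powr_minus_divide powr_half_sqrt)
  qed
qed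

subsection \<open>Incidences\<close>

text \<open>The Gaussian Fourier identity is applied to the triple product measure and the map
  \<open>p - q - \<gamma> s\<close>; the transform of that image factors into three transforms.
  Working with extended nonnegative integrals admits an infinite right side.\<close>

lemma convolution_gaussian_le_fourier:
  fixes \<mu> \<nu> :: "(real \<times> real) measure" and \<gamma> :: "'a \<Rightarrow> real \<times> real"
  assumes \<mu>: "finite_borel_measure \<mu>" and \<nu>: "finite_borel_measure \<nu>"
    and \<kappa>: "finite_measure \<kappa>" and \<gamma>[measurable]: "\<gamma> \<in> borel_measurable \<kappa>" and r: "r > 0"
  shows "(\<integral>\<^sup>+p. \<integral>\<^sup>+q. \<integral>\<^sup>+s. ennreal (exp (- (norm (p - q - \<gamma> s))\<^sup>2 / (4 * r))) \<partial>\<kappa> \<partial>\<nu> \<partial>\<mu>)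
    \<le> ennreal (r / pi) * (\<integral>\<^sup>+\<xi>. ennreal (norm (fourier_measure \<mu> \<xi>) * norm (fourier_measure \<nu> \<xi>)
          * norm (\<integral>s. cis (\<gamma> s \<bullet> \<xi>) \<partial>\<kappa>)) \<partial>lborel)"
proof -
  have [measurable_cong]: "sets \<mu> = sets borel" "sets \<nu> = sets borel"
    and "finite_measure \<mu>" "finite_measure \<nu>"
    using \<mu> \<nu> by (auto simp: finite_borel_measure_def)
  interpret \<mu>: finite_measure \<mu> by fact
  interpret \<nu>: finite_measure \<nu> by fact
  interpret \<kappa>: finite_measure \<kappa> by fact
  interpret N: pair_sigma_finite \<nu> \<kappa> ..
  have fN: "finite_measure (\<nu> \<Otimes>\<^sub>M \<kappa>)"
    by (intro finite_measure_pair_measure) fact+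
  interpret fN: finite_measure "\<nu> \<Otimes>\<^sub>M \<kappa>" by fact
  interpret X: pair_sigma_finite \<mu> "\<nu> \<Otimes>\<^sub>M \<kappa>" ..
  have fX: "finite_measure (\<mu> \<Otimes>\<^sub>M (\<nu> \<Otimes>\<^sub>M \<kappa>))"
    by (intro finite_measure_pair_measure) fact+
  interpret fX: finite_measure "\<mu> \<Otimes>\<^sub>M (\<nu> \<Otimes>\<^sub>M \<kappa>)" by fact
  define \<theta> where "\<theta> z = fst z - fst (snd z) - \<gamma> (snd (snd z))" for z
  have \<theta>[measurable]: "\<theta> \<in> borel_measurable (\<mu> \<Otimes>\<^sub>M (\<nu> \<Otimes>\<^sub>M \<kappa>))"
    unfolding \<theta>_def by measurable
  have i1: "integrable \<mu> (\<lambda>x. cis (x \<bullet> \<xi>))" and i2: "integrable \<nu> (\<lambda>x. cis (x \<bullet> \<xi>))"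
    and i3: "integrable \<kappa> (\<lambda>x. cis (\<gamma> x \<bullet> \<xi>))" for \<xi>
    by (rule \<mu>.integrable_const_bound [of _ 1] \<nu>.integrable_const_bound [of _ 1]
          \<kappa>.integrable_const_bound [of _ 1]; simp)+
  have "(\<integral>z. cis (\<theta> z \<bullet> \<xi>) \<partial>(\<mu> \<Otimes>\<^sub>M (\<nu> \<Otimes>\<^sub>M \<kappa>)))
      = fourier_measure \<mu> \<xi> * (fourier_measure \<nu> (- \<xi>) * (\<integral>s. cis (\<gamma> s \<bullet> (- \<xi>)) \<partial>\<kappa>))" for \<xi>
  proof -
    have "(\<integral>z. cis (\<theta> z \<bullet> \<xi>) \<partial>(\<mu> \<Otimes>\<^sub>M (\<nu> \<Otimes>\<^sub>M \<kappa>)))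
       = (\<integral>z. (case z of (p, w) \<Rightarrow> cis (p \<bullet> \<xi>) * (case w of (q, s) \<Rightarrow> cis (q \<bullet> (- \<xi>)) * cis (\<gamma> s \<bullet> (- \<xi>)))) \<partial>(\<mu> \<Otimes>\<^sub>M (\<nu> \<Otimes>\<^sub>M \<kappa>)))"
      by (simp add: \<theta>_def case_prod_unfold inner_diff_left cis_mult algebra_simps)
    also have "\<dots> = fourier_measure \<mu> \<xi> * (\<integral>w. (case w of (q, s) \<Rightarrow> cis (q \<bullet> (- \<xi>)) * cis (\<gamma> s \<bullet> (- \<xi>))) \<partial>(\<nu> \<Otimes>\<^sub>M \<kappa>))"
      unfolding fourier_measure_def by (rule X.integral_pair_mult [OF i1 N.integrable_pair_mult [OF i2 i3]])
    also have "(\<integral>w. (case w of (q, s) \<Rightarrow> cis (q \<bullet> (- \<xi>)) * cis (\<gamma> s \<bullet> (- \<xi>))) \<partial>(\<nu> \<Otimes>\<^sub>M \<kappa>))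
        = fourier_measure \<nu> (- \<xi>) * (\<integral>s. cis (\<gamma> s \<bullet> (- \<xi>)) \<partial>\<kappa>)"
      unfolding fourier_measure_def by (rule N.integral_pair_mult [OF i2 i3])
    finally show ?thesis .
  qed
  \<comment> \<open>The minus signs on \<open>q\<close> and \<open>\<gamma> s\<close> only conjugate
    their factors, which the norm does not see.\<close>
  moreover have "norm (\<integral>s. cis (\<gamma> s \<bullet> (- \<xi>)) \<partial>\<kappa>) = norm (\<integral>s. cis (\<gamma> s \<bullet> \<xi>) \<partial>\<kappa>)" for \<xi>
    by (simp flip: cis_cnj)
  ultimately have nX: "norm (\<integral>z. cis (\<theta> z \<bullet> \<xi>) \<partial>(\<mu> \<Otimes>\<^sub>M (\<nu> \<Otimes>\<^sub>M \<kappa>)))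
     = norm (fourier_measure \<mu> \<xi>) * norm (fourier_measure \<nu> \<xi>) * norm (\<integral>s. cis (\<gamma> s \<bullet> \<xi>) \<partial>\<kappa>)" for \<xi>
    by (simp only: norm_mult fourier_measure_uminus complex_mod_cnj mult.assoc)
  let ?E = "\<integral>z. exp (- (norm (\<theta> z))\<^sup>2 / (4 * r)) \<partial>(\<mu> \<Otimes>\<^sub>M (\<nu> \<Otimes>\<^sub>M \<kappa>))"
  let ?G = "\<lambda>\<xi>. complex_of_real (exp (- r * (norm \<xi>)\<^sup>2)) * (\<integral>z. cis (\<theta> z \<bullet> \<xi>) \<partial>(\<mu> \<Otimes>\<^sub>M (\<nu> \<Otimes>\<^sub>M \<kappa>)))"
  have E: "?E \<ge> 0" by simp
  have "ennreal (pi / r * ?E) = ennreal (norm (complex_of_real (pi / r * ?E)))"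
    using E r by (simp only: norm_of_real) simp
  also have "\<dots> = ennreal (norm (\<integral>\<xi>. ?G \<xi> \<partial>lborel))"
    by (simp only: gaussian_fourier [OF fX \<theta> r])
  also have "\<dots> \<le> (\<integral>\<^sup>+\<xi>. ennreal (norm (?G \<xi>)) \<partial>lborel)"
    by (rule integral_norm_bound_ennreal [OF integrable_gaussian_fourier [OF fX \<theta> r]])
  \<comment> \<open>The Gaussian factor \<open>exp (- r * (norm \<xi>)\<^sup>2)\<close> is bounded
    by 1.\<close>
  also have "\<dots> \<le> (\<integral>\<^sup>+\<xi>. ennreal (norm (fourier_measure \<mu> \<xi>) * norm (fourier_measure \<nu> \<xi>)
          * norm (\<integral>s. cis (\<gamma> s \<bullet> \<xi>) \<partial>\<kappa>)) \<partial>lborel)" (is "_ \<le> ?R")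
    using r by (intro nn_integral_mono ennreal_leI)
      (simp add: norm_mult nX del: of_real_exp, intro mult_left_le_one_le, auto)
  finally have "ennreal (pi / r * ?E) \<le> ?R" .
  then have "ennreal (r / pi) * ennreal (pi / r * ?E) \<le> ennreal (r / pi) * ?R"
    by (intro mult_left_mono) auto
  moreover have "ennreal (r / pi) * ennreal (pi / r * ?E) = ennreal ?E"
    using r E by (subst ennreal_mult [symmetric]) auto
  ultimately have le: "ennreal ?E \<le> ennreal (r / pi) * ?R" by simp
  have "integrable (\<mu> \<Otimes>\<^sub>M (\<nu> \<Otimes>\<^sub>M \<kappa>)) (\<lambda>z. exp (- (norm (\<theta> z))\<^sup>2 / (4 * r)))"
    using r by (intro fX.integrable_const_bound [of _ 1]) auto
  then have "ennreal ?E = (\<integral>\<^sup>+z. ennreal (exp (- (norm (\<theta> z))\<^sup>2 / (4 * r))) \<partial>(\<mu> \<Otimes>\<^sub>M (\<nu> \<Otimes>\<^sub>M \<kappa>)))"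
    by (intro nn_integral_eq_integral [symmetric]) auto
  also have "\<dots> = (\<integral>\<^sup>+p. \<integral>\<^sup>+w. ennreal (exp (- (norm (\<theta> (p, w)))\<^sup>2 / (4 * r))) \<partial>(\<nu> \<Otimes>\<^sub>M \<kappa>) \<partial>\<mu>)"
    by (rule sigma_finite_measure.nn_integral_fst [OF finite_measure.axioms(1) [OF fN], symmetric]) measurable
  also have "\<dots> = (\<integral>\<^sup>+p. \<integral>\<^sup>+q. \<integral>\<^sup>+s. ennreal (exp (- (norm (\<theta> (p, q, s)))\<^sup>2 / (4 * r))) \<partial>\<kappa> \<partial>\<nu> \<partial>\<mu>)"
    by (intro nn_integral_cong \<kappa>.nn_integral_fst [symmetric]) measurable
  finally show ?thesis
    using le by (simp add: \<theta>_def)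
qed

text \<open>If \<open>p - q\<close> is within \<open>\<delta>\<close> of the curve point over
  \<open>s0\<close>, it is within \<open>(2 + L) * \<delta>\<close> of the curve points over a
  parameter interval of length \<open>\<delta>\<close>. There the Gaussian is bounded below by a
  constant, so its integral over the curve is at least that constant times
  \<open>\<delta>\<close>.\<close>

lemma incidence_le_gaussian_average:
  fixes \<psi> \<psi>' :: "real \<Rightarrow> real"
  assumes \<psi>: "\<And>x. (\<psi> has_real_derivative \<psi>' x) (at x)"
    and L: "\<And>x. x \<in> {-1..1} \<Longrightarrow> \<bar>\<psi>' x\<bar> \<le> L"
    and \<delta>: "0 < \<delta>" "\<delta> < 1"
    and pq: "p \<in> closed_nbhd (translated_graph \<psi> q) \<delta>"
  shows "1 \<le> ennreal (exp ((2 + L)\<^sup>2 / 2) / \<delta>) *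
     (\<integral>\<^sup>+s. ennreal (exp (- (norm (p - q - (s, \<psi> s)))\<^sup>2 / (2 * \<delta>\<^sup>2))) \<partial>restrict_space lborel {-1..1})"
proof -
  have c\<psi>: "continuous_on A \<psi>" for A
    using \<psi> by (meson DERIV_continuous_on has_field_derivative_at_within)
  have [measurable]: "\<psi> \<in> borel_measurable borel"
    by (intro borel_measurable_continuous_onI c\<psi>)
  have "L \<ge> 0" using L [of 0] by (auto intro: order.trans [OF abs_ge_zero])
  have "closed (curve_graph \<psi>)"
    unfolding curve_graph_def
    by (intro compact_imp_closed compact_continuous_image continuous_intros c\<psi> compact_Icc)
  \<comment> \<open>Closedness makes the infimal distance attained, which yields an actual point
    \<open>s0\<close> at distance at most \<open>\<delta>\<close>, with no loss in the
    constant.\<close>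
  then have "closed (translated_graph \<psi> q)" "translated_graph \<psi> q \<noteq> {}"
    unfolding translated_graph_def by (auto simp: closed_translation curve_graph_def)
  then obtain z where z: "z \<in> translated_graph \<psi> q" "infdist p (translated_graph \<psi> q) = dist p z"
    using infdist_attains_inf by metis
  then obtain s0 where s0: "s0 \<in> {-1..1}" "norm (p - (q + (s0, \<psi> s0))) \<le> \<delta>"
    using pq by (auto simp: translated_graph_def curve_graph_def closed_nbhd_def dist_norm)
  \<comment> \<open>The interval extends from \<open>s0\<close> towards the centre of
    \<open>{-1..1}\<close>, so with \<open>\<delta> < 1\<close> it never leaves the parameter
    range.\<close>
  define l where "l = (if s0 \<le> 0 then s0 else s0 - \<delta>)"
  have l: "{l..l + \<delta>} \<subseteq> {-1..1}" "\<And>s. s \<in> {l..l + \<delta>} \<Longrightarrow> \<bar>s - s0\<bar> \<le> \<delta>"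
    using s0 \<delta> by (auto simp: l_def split: if_splits)
  \<comment> \<open>The value of the Gaussian exponent at distance
    \<open>(2 + L) * \<delta>\<close>: one \<open>\<delta>\<close> for the distance to the curve
    point, one for the change of parameter, and \<open>L * \<delta>\<close> for the change of
    \<open>\<psi>\<close>.\<close>
  define k where "k = exp (- (2 + L)\<^sup>2 / 2)"
  have k: "k \<le> exp (- (norm (p - q - (s, \<psi> s)))\<^sup>2 / (2 * \<delta>\<^sup>2))" if s: "s \<in> {l..l + \<delta>}" for s
  proof -
    have s': "\<bar>s - s0\<bar> \<le> \<delta>" "s \<in> {-1..1}" using l s by auto
    have "norm (\<psi> s0 - \<psi> s) \<le> L * norm (s0 - s)"
      using s0 s' L \<psi> by (intro field_differentiable_bound [of "{-1..1}" \<psi> \<psi>'])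
         (auto intro: has_field_derivative_at_within)
    also have "\<dots> \<le> L * \<delta>"
      using s' \<open>L \<ge> 0\<close> by (intro mult_left_mono) (auto simp: abs_minus_commute)
    finally have psi: "\<bar>\<psi> s0 - \<psi> s\<bar> \<le> L * \<delta>" by simp
    have "p - q - (s, \<psi> s) = (p - (q + (s0, \<psi> s0))) + (s0 - s, \<psi> s0 - \<psi> s)"
      by (simp add: prod_eq_iff)
    then have "norm (p - q - (s, \<psi> s)) \<le> norm (p - (q + (s0, \<psi> s0))) + norm (s0 - s, \<psi> s0 - \<psi> s)"
      using norm_triangle_ineq by metis
    also have "norm (s0 - s, \<psi> s0 - \<psi> s) \<le> \<bar>s0 - s\<bar> + \<bar>\<psi> s0 - \<psi> s\<bar>"
      using norm_Pair_le [of "s0 - s" "\<psi> s0 - \<psi> s"] by simp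
    also have "norm (p - (q + (s0, \<psi> s0))) + (\<bar>s0 - s\<bar> + \<bar>\<psi> s0 - \<psi> s\<bar>) \<le> \<delta> + (\<delta> + L * \<delta>)"
      using s0 s' psi by (intro add_mono) (auto simp: abs_minus_commute)
    also have "\<dots> = (2 + L) * \<delta>" by (simp add: algebra_simps)
    finally have "(norm (p - q - (s, \<psi> s)))\<^sup>2 \<le> ((2 + L) * \<delta>)\<^sup>2"
      by (intro power_mono) auto
    then have "(norm (p - q - (s, \<psi> s)))\<^sup>2 / (2 * \<delta>\<^sup>2) \<le> ((2 + L) * \<delta>)\<^sup>2 / (2 * \<delta>\<^sup>2)"
      by (intro divide_right_mono) auto
    also have "\<dots> = (2 + L)\<^sup>2 / 2"
      using \<delta> by (simp add: power_mult_distrib)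
    finally show ?thesis
      by (simp add: k_def)
  qed
  have "ennreal (k * \<delta>) = (\<integral>\<^sup>+s. ennreal k * indicator {l..l + \<delta>} s \<partial>lborel)"
    using \<delta> by (simp add: nn_integral_cmult_indicator k_def ennreal_mult)
  also have "\<dots> \<le> (\<integral>\<^sup>+s. ennreal (exp (- (norm (p - q - (s, \<psi> s)))\<^sup>2 / (2 * \<delta>\<^sup>2))) * indicator {-1..1} s \<partial>lborel)"
    using l(1) k by (intro nn_integral_mono) (auto simp: indicator_def intro!: ennreal_leI)
  also have "\<dots> = (\<integral>\<^sup>+s. ennreal (exp (- (norm (p - q - (s, \<psi> s)))\<^sup>2 / (2 * \<delta>\<^sup>2))) \<partial>restrict_space lborel {-1..1})"
    by (subst nn_integral_restrict_space) auto
  finally have "ennreal (exp ((2 + L)\<^sup>2 / 2) / \<delta>) * ennreal (k * \<delta>) \<le> ennreal (exp ((2 + L)\<^sup>2 / 2) / \<delta>) * \<dots>"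
    by (intro mult_left_mono) auto
  moreover have "ennreal (exp ((2 + L)\<^sup>2 / 2) / \<delta>) * ennreal (k * \<delta>) = 1"
    using \<delta> by (subst ennreal_mult [symmetric]) (auto simp: k_def exp_minus field_simps)
  ultimately show ?thesis by simp
qed

section \<open>Square roots of extended reals and the incidence bound\<close>

lemma le_ennreal_sqrt:
  assumes "x\<^sup>2 \<le> y"
  shows "x \<le> ennreal_sqrt y"
proof (cases y)
  case (real b)
  have "x \<noteq> \<top>" using assms real by (auto simp: power2_eq_square ennreal_mult_top top_unique)
  then obtain a where "x = ennreal a" "a \<ge> 0" by (cases x) auto
  then show ?thesis
    using assms real by (auto simp: ennreal_sqrt_def ennreal_power intro!: ennreal_leI real_le_rsqrt)
qed (simp add: ennreal_sqrt_def)

lemma ennreal_sqrt_cmult: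
  "c \<ge> 0 \<Longrightarrow> ennreal_sqrt (ennreal (c\<^sup>2) * x) \<le> ennreal c * ennreal_sqrt x"
  by (cases "c = 0"; cases x)
    (auto simp: ennreal_sqrt_def ennreal_mult_top real_sqrt_mult simp flip: ennreal_mult)

theorem theorem1p21:
  fixes \<psi> :: "real \<Rightarrow> real" and t :: real
  assumes "\<psi> C1_differentiable_on UNIV"
    and "deriv \<psi> C1_differentiable_on UNIV"
    and "\<And>x. deriv (deriv \<psi>) x > 0"
    and "1 < t" and "t < 2"
  shows "\<exists>C>0. \<forall>(\<mu> :: (real \<times> real) measure) (\<nu> :: (real \<times> real) measure) (\<delta> :: real).
    finite_borel_measure \<mu> \<longrightarrow> finite_borel_measure \<nu> \<longrightarrow>
    compact (measure_support \<mu>) \<longrightarrow> measure_support \<mu> \<subseteq> cball 0 1 \<longrightarrow>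
    compact (measure_support \<nu>) \<longrightarrow> measure_support \<nu> \<subseteq> cball 0 1 \<longrightarrow>
    0 < \<delta> \<longrightarrow> \<delta> < 1 \<longrightarrow>
    incidences \<psi> \<delta> \<mu> \<nu> \<le>
      ennreal C * ennreal \<delta> * ennreal_sqrt (riesz_energy (3 - t) \<mu> * riesz_energy t \<nu>)"
proof -
  \<comment> \<open>Identifies the derivative provided by \<open>C1_differentiable_on\<close> with
    \<open>deriv\<close>; used once for \<open>\<psi>\<close> and once for
    \<open>deriv \<psi>\<close>.\<close>
  have deriv: "(f has_real_derivative deriv f x) (at x)" "continuous_on UNIV (deriv f)"
    if C1: "f C1_differentiable_on UNIV" for f :: "real \<Rightarrow> real" and x
  proof -
    obtain D where D: "\<And>x. (f has_real_derivative D x) (at x)" "continuous_on UNIV D"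
      using C1 by (auto simp: C1_differentiable_on_def has_real_derivative_iff_has_vector_derivative)
    have "deriv f = D" using D(1) by (auto intro: DERIV_imp_deriv)
    then show "(f has_real_derivative deriv f x) (at x)" "continuous_on UNIV (deriv f)"
      using D by auto
  qed
  note d\<psi> = deriv(1) [OF assms(1)] and d\<psi>' = deriv(1) [OF assms(2)]
  have c\<psi>: "continuous_on A \<psi>" for A
    using d\<psi> by (meson DERIV_continuous_on has_field_derivative_at_within)
  have [measurable]: "\<psi> \<in> borel_measurable borel"
    by (intro borel_measurable_continuous_onI c\<psi>)
  have "bounded (deriv \<psi> ` {-1..1})"
    using deriv(2) [OF assms(1)] by (intro compact_imp_bounded compact_continuous_image compact_Icc)
       (auto intro: continuous_on_subset)
  then obtain L where L: "\<And>x. x \<in> {-1..1} \<Longrightarrow> \<bar>deriv \<psi> x\<bar> \<le> L"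
    by (fastforce simp: bounded_iff)
  define c0 where "c0 = exp ((2 + L)\<^sup>2 / 2)"
  obtain c1 where c1: "c1 \<ge> 0" "\<And>\<xi>. \<xi> \<noteq> 0 \<Longrightarrow>
      norm (integral {-1..1} (\<lambda>x. cis ((x, \<psi> x) \<bullet> \<xi>))) \<le> c1 * norm \<xi> powr (-1/2)"
    using curve_fourier_decay [OF d\<psi> d\<psi>' continuous_on_subset [OF deriv(2) [OF assms(2)]] assms(3)] by auto
  obtain c2 where c2: "c2 \<ge> 0" "\<And>\<mu> :: (real \<times> real) measure. finite_borel_measure \<mu> \<Longrightarrow>
    (\<integral>\<^sup>+\<xi>. ennreal ((norm (fourier_measure \<mu> \<xi>))\<^sup>2 * norm \<xi> powr (3 - t - 2)) \<partial>lborel)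
      \<le> ennreal c2 * riesz_energy (3 - t) \<mu>"
    using fourier_energy_le_riesz_energy [of "3 - t"] assms by auto
  obtain c3 where c3: "c3 \<ge> 0" "\<And>\<mu> :: (real \<times> real) measure. finite_borel_measure \<mu> \<Longrightarrow>
    (\<integral>\<^sup>+\<xi>. ennreal ((norm (fourier_measure \<mu> \<xi>))\<^sup>2 * norm \<xi> powr (t - 2)) \<partial>lborel)
      \<le> ennreal c3 * riesz_energy t \<mu>"
    using fourier_energy_le_riesz_energy [of t] assms by auto
  \<comment> \<open>The factors come from the Gaussian average and its normalisation, the decay of
    the curve, and the two energy comparisons. The added 1 ensures positivity when one of
    \<open>c1\<close>, \<open>c2\<close>, \<open>c3\<close> is 0.\<close>
  define C where "C = c0 / (2 * pi) * (c1 * sqrt (c2 * c3)) + 1"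
  have c0: "c0 > 0" by (simp add: c0_def)
  have "C > 0" using c0 c1 c2 c3 by (simp add: C_def add_nonneg_pos)
  moreover have "incidences \<psi> \<delta> \<mu> \<nu> \<le>
      ennreal C * ennreal \<delta> * ennreal_sqrt (riesz_energy (3 - t) \<mu> * riesz_energy t \<nu>)"
    if \<mu>: "finite_borel_measure \<mu>" and \<nu>: "finite_borel_measure \<nu>" and \<delta>: "0 < \<delta>" "\<delta> < 1"
    for \<mu> \<nu> :: "(real \<times> real) measure" and \<delta>
  proof -
    have [measurable_cong]: "sets \<mu> = sets borel" "sets \<nu> = sets borel"
      and "finite_measure \<mu>" "finite_measure \<nu>"
      using \<mu> \<nu> by (auto simp: finite_borel_measure_def)
    interpret \<mu>: finite_measure \<mu> by fact
    interpret \<nu>: finite_measure \<nu> by fact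
    define \<kappa> where "\<kappa> = restrict_space lborel {-1..1::real}"
    interpret \<kappa>: finite_measure \<kappa>
      unfolding \<kappa>_def by (intro finite_measure_restrict_space finite_measureI) (auto simp: emeasure_restrict_space space_restrict_space)
    define \<gamma> where "\<gamma> s = (s, \<psi> s)" for s
    have \<gamma>[measurable]: "\<gamma> \<in> borel_measurable \<kappa>"
      unfolding \<kappa>_def \<gamma>_def by (intro measurable_restrict_space1) measurable
    note [measurable] = fourier_measure_borel_measurable [OF \<mu>] fourier_measure_borel_measurable [OF \<nu>]
    \<comment> \<open>Passes from the Lebesgue integral of the Fourier argument to the gauge
      integral in which the decay estimate is stated.\<close>
    have \<kappa>_eq: "(\<integral>s. cis (\<gamma> s \<bullet> \<xi>) \<partial>\<kappa>) = integral {-1..1} (\<lambda>s. cis ((s, \<psi> s) \<bullet> \<xi>))" for \<xi>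
    proof -
      have "set_integrable lborel {-1..1} (\<lambda>s. cis ((s, \<psi> s) \<bullet> \<xi>))"
        by (intro borel_integrable_compact [OF compact_Icc, folded set_integrable_def] continuous_intros c\<psi>)
      then show ?thesis
        unfolding \<kappa>_def \<gamma>_def by (subst integral_restrict_space)
          (auto simp: set_lebesgue_integral_def [symmetric] set_borel_integral_eq_integral(2))
    qed
    let ?S = "{(p, q). p \<in> closed_nbhd (translated_graph \<psi> q) \<delta>}"
    let ?g = "\<lambda>p q s. ennreal (exp (- (norm (p - q - \<gamma> s))\<^sup>2 / (2 * \<delta>\<^sup>2)))"
    have [measurable]: "?S \<in> sets (\<mu> \<Otimes>\<^sub>M \<nu>)"
      by (rule incidence_set_measurable [OF \<mu> \<nu>])
    have [measurable]: "(\<lambda>z. ?g (fst (fst z)) (snd (fst z)) (snd z)) \<in> borel_measurable ((\<mu> \<Otimes>\<^sub>M \<nu>) \<Otimes>\<^sub>M \<kappa>)"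
      by measurable
    \<comment> \<open>The exponents of \<open>a\<close> and \<open>b\<close> are half of
      \<open>\<omega> - 2\<close> for \<open>\<omega> = 3 - t\<close> and
      \<open>\<omega> = t\<close>, so the squares carry the energy weights.\<close>
    define a where "a \<xi> = norm (fourier_measure \<mu> \<xi>) * norm \<xi> powr ((1 - t) / 2)" for \<xi>
    define b where "b \<xi> = norm (fourier_measure \<nu> \<xi>) * norm \<xi> powr ((t - 2) / 2)" for \<xi>
    have [measurable]: "a \<in> borel_measurable borel" "b \<in> borel_measurable borel"
      unfolding a_def b_def by measurable
    have ab: "a \<xi> \<ge> 0" "b \<xi> \<ge> 0" for \<xi> by (auto simp: a_def b_def)
    have a2: "(a \<xi>)\<^sup>2 = (norm (fourier_measure \<mu> \<xi>))\<^sup>2 * norm \<xi> powr (3 - t - 2)" for \<xi>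
      by (simp add: a_def power_mult_distrib power2_eq_square flip: powr_add)
    have b2: "(b \<xi>)\<^sup>2 = (norm (fourier_measure \<nu> \<xi>))\<^sup>2 * norm \<xi> powr (t - 2)" for \<xi>
      by (simp add: b_def power_mult_distrib power2_eq_square flip: powr_add)
    have "incidences \<psi> \<delta> \<mu> \<nu> = (\<integral>\<^sup>+p. \<integral>\<^sup>+q. indicator ?S (p, q) \<partial>\<nu> \<partial>\<mu>)"
      unfolding incidences_def by (subst \<nu>.nn_integral_fst) (auto simp: nn_integral_indicator)
    also have "\<dots> \<le> (\<integral>\<^sup>+p. \<integral>\<^sup>+q. ennreal (c0 / \<delta>) * (\<integral>\<^sup>+s. ?g p q s \<partial>\<kappa>) \<partial>\<nu> \<partial>\<mu>)"
      using incidence_le_gaussian_average [OF d\<psi> L \<delta>]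
      by (intro nn_integral_mono) (auto simp: indicator_def c0_def \<kappa>_def \<gamma>_def)
    also have "\<dots> = ennreal (c0 / \<delta>) * (\<integral>\<^sup>+p. \<integral>\<^sup>+q. \<integral>\<^sup>+s. ?g p q s \<partial>\<kappa> \<partial>\<nu> \<partial>\<mu>)"
      by (simp add: nn_integral_cmult)
    also have "\<dots> \<le> ennreal (c0 / \<delta>) * (ennreal (\<delta>\<^sup>2 / 2 / pi) * (\<integral>\<^sup>+\<xi>. ennreal (norm (fourier_measure \<mu> \<xi>)
         * norm (fourier_measure \<nu> \<xi>) * norm (\<integral>s. cis (\<gamma> s \<bullet> \<xi>) \<partial>\<kappa>)) \<partial>lborel))"
      \<comment> \<open>With \<open>r = \<delta>\<^sup>2 / 2\<close> the exponent denominator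
        \<open>4 * r\<close> is the \<open>2 * \<delta>\<^sup>2\<close> of the Gaussian
        average.\<close>
      using convolution_gaussian_le_fourier [OF \<mu> \<nu> \<kappa>.finite_measure_axioms \<gamma>, of "\<delta>\<^sup>2 / 2"] \<delta>
      by (intro mult_left_mono) auto
    also have "\<dots> = ennreal (c0 / (2 * pi) * \<delta>) * (\<integral>\<^sup>+\<xi>. ennreal (norm (fourier_measure \<mu> \<xi>)
         * norm (fourier_measure \<nu> \<xi>) * norm (\<integral>s. cis (\<gamma> s \<bullet> \<xi>) \<partial>\<kappa>)) \<partial>lborel)"
    proof -
      \<comment> \<open>One factor \<delta> survives: the average costs \<open>1 / \<delta>\<close>
        and the planar Gaussian gains the square of \<delta>.\<close>
      have "c0 / \<delta> * (\<delta>\<^sup>2 / 2 / pi) = c0 / (2 * pi) * \<delta>"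
        using \<delta> by (simp add: power2_eq_square field_simps)
      then show ?thesis
        using \<delta> c0 by (subst mult.assoc [symmetric], subst ennreal_mult [symmetric]) auto
    qed
    also have "(\<integral>\<^sup>+\<xi>. ennreal (norm (fourier_measure \<mu> \<xi>) * norm (fourier_measure \<nu> \<xi>) * norm (\<integral>s. cis (\<gamma> s \<bullet> \<xi>) \<partial>\<kappa>)) \<partial>lborel)
       \<le> (\<integral>\<^sup>+\<xi>. ennreal c1 * (ennreal (a \<xi>) * ennreal (b \<xi>)) \<partial>lborel)"
    \<comment> \<open>The decay estimate excludes the origin, which is a null set.\<close>
    proof (intro nn_integral_mono_AE)
      have "ennreal (norm (fourier_measure \<mu> \<xi>) * norm (fourier_measure \<nu> \<xi>) * norm (\<integral>s. cis (\<gamma> s \<bullet> \<xi>) \<partial>\<kappa>))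
         \<le> ennreal c1 * (ennreal (a \<xi>) * ennreal (b \<xi>))" if "\<xi> \<noteq> 0" for \<xi>
      proof -
        have "norm (fourier_measure \<mu> \<xi>) * norm (fourier_measure \<nu> \<xi>) * norm (\<integral>s. cis (\<gamma> s \<bullet> \<xi>) \<partial>\<kappa>)
           \<le> norm (fourier_measure \<mu> \<xi>) * norm (fourier_measure \<nu> \<xi>) * (c1 * norm \<xi> powr (-1/2))"
          unfolding \<kappa>_eq by (intro mult_left_mono c1 that) auto
        also have "norm \<xi> powr (-1/2) = norm \<xi> powr ((1 - t) / 2) * norm \<xi> powr ((t - 2) / 2)"
          by (simp flip: powr_add add_divide_distrib)
        finally show ?thesis
          using ab c1(1) by (simp add: a_def b_def mult_ac flip: ennreal_mult)
      qed
      then show "AE \<xi> in lborel. ennreal (norm (fourier_measure \<mu> \<xi>) * norm (fourier_measure \<nu> \<xi>) * norm (\<integral>s. cis (\<gamma> s \<bullet> \<xi>) \<partial>\<kappa>))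
         \<le> ennreal c1 * (ennreal (a \<xi>) * ennreal (b \<xi>))"
        using AE_lborel_singleton [of "0 :: real \<times> real"] by (auto elim: eventually_mono)
    qed
    also have "\<dots> = ennreal c1 * (\<integral>\<^sup>+\<xi>. ennreal (a \<xi>) * ennreal (b \<xi>) \<partial>lborel)"
      by (intro nn_integral_cmult) measurable
    also have "(\<integral>\<^sup>+\<xi>. ennreal (a \<xi>) * ennreal (b \<xi>) \<partial>lborel)
       \<le> ennreal_sqrt (ennreal ((sqrt (c2 * c3))\<^sup>2) * (riesz_energy (3 - t) \<mu> * riesz_energy t \<nu>))"
    \<comment> \<open>Comparing squares avoids separate cases for zero or infinite energies.\<close>
    proof (rule le_ennreal_sqrt)
      have "(\<integral>\<^sup>+\<xi>. ennreal (a \<xi>) * ennreal (b \<xi>) \<partial>lborel)\<^sup>2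
         \<le> (\<integral>\<^sup>+\<xi>. (ennreal (a \<xi>))\<^sup>2 \<partial>lborel) * (\<integral>\<^sup>+\<xi>. (ennreal (b \<xi>))\<^sup>2 \<partial>lborel)"
        by (intro Cauchy_Schwarz_nn_integral) measurable
      also have "(\<lambda>\<xi>. (ennreal (a \<xi>))\<^sup>2) = (\<lambda>\<xi>. ennreal ((norm (fourier_measure \<mu> \<xi>))\<^sup>2 * norm \<xi> powr (3 - t - 2)))"
        using ab by (simp add: ennreal_power a2)
      also have "(\<lambda>\<xi>. (ennreal (b \<xi>))\<^sup>2) = (\<lambda>\<xi>. ennreal ((norm (fourier_measure \<nu> \<xi>))\<^sup>2 * norm \<xi> powr (t - 2)))"
        using ab by (simp add: ennreal_power b2)
      also have "(\<integral>\<^sup>+\<xi>. ennreal ((norm (fourier_measure \<mu> \<xi>))\<^sup>2 * norm \<xi> powr (3 - t - 2)) \<partial>lborel)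
           * (\<integral>\<^sup>+\<xi>. ennreal ((norm (fourier_measure \<nu> \<xi>))\<^sup>2 * norm \<xi> powr (t - 2)) \<partial>lborel)
         \<le> (ennreal c2 * riesz_energy (3 - t) \<mu>) * (ennreal c3 * riesz_energy t \<nu>)"
        by (intro mult_mono c2 c3 \<mu> \<nu>) auto
      also have "\<dots> = ennreal ((sqrt (c2 * c3))\<^sup>2) * (riesz_energy (3 - t) \<mu> * riesz_energy t \<nu>)"
        using c2(1) c3(1) by (simp add: ennreal_mult mult_ac)
      finally show "(\<integral>\<^sup>+\<xi>. ennreal (a \<xi>) * ennreal (b \<xi>) \<partial>lborel)\<^sup>2
         \<le> ennreal ((sqrt (c2 * c3))\<^sup>2) * (riesz_energy (3 - t) \<mu> * riesz_energy t \<nu>)" .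
    qed
    also have "\<dots> \<le> ennreal (sqrt (c2 * c3)) * ennreal_sqrt (riesz_energy (3 - t) \<mu> * riesz_energy t \<nu>)"
      using c2(1) c3(1) by (intro ennreal_sqrt_cmult) auto
    finally have "incidences \<psi> \<delta> \<mu> \<nu> \<le> ennreal (c0 / (2 * pi) * \<delta>) * (ennreal c1 * (ennreal (sqrt (c2 * c3))
        * ennreal_sqrt (riesz_energy (3 - t) \<mu> * riesz_energy t \<nu>)))"
      by (simp add: mult_left_mono)
    also have "\<dots> = ennreal ((c0 / (2 * pi) * \<delta>) * (c1 * sqrt (c2 * c3))) * ennreal_sqrt (riesz_energy (3 - t) \<mu> * riesz_energy t \<nu>)"
    proof -
      have n: "0 \<le> c0 / (2 * pi) * \<delta>" "0 \<le> sqrt (c2 * c3)"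
        using c0 c2(1) c3(1) \<delta> by auto
      show ?thesis
        unfolding ennreal_mult [OF n(1) mult_nonneg_nonneg [OF c1(1) n(2)]] ennreal_mult [OF c1(1) n(2)]
        by (simp only: mult.assoc)
    qed
    also have "\<dots> \<le> ennreal (C * \<delta>) * ennreal_sqrt (riesz_energy (3 - t) \<mu> * riesz_energy t \<nu>)"
    proof (intro mult_right_mono ennreal_leI)
      \<comment> \<open>The constant obtained so far is \<open>C - 1\<close>, by the 1 added in the
        definition of \<open>C\<close>.\<close>
      have "c0 / (2 * pi) * \<delta> * (c1 * sqrt (c2 * c3)) = (C - 1) * \<delta>"
        by (simp add: C_def)
      also have "\<dots> \<le> C * \<delta>"
        using \<delta> by (intro mult_right_mono) auto
      finally show "c0 / (2 * pi) * \<delta> * (c1 * sqrt (c2 * c3)) \<le> C * \<delta>" .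
    qed simp
    also have "ennreal (C * \<delta>) = ennreal C * ennreal \<delta>"
      using \<open>C > 0\<close> \<delta> by (simp add: ennreal_mult)
    finally show ?thesis .
  qed
  ultimately show ?thesis by blast
qed

end
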